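(* Let $\Omega$ be a compact topological space, $T:\Omega\to\Omega$ a homeomorphism, and $A:\Omega\to\mathrm{SL}(2,\mathbb{R})$ a continuous map. For $\delta>0$ put $\rho(\delta)=\left(\delta+\frac3\delta\right)\left(\frac\delta2+1\right)$. Then $(T,A)$ is uniformly hyperbolic if and only if there are an integer $k\ge1$ and a $\delta_0>0$ such that for all $\omega\in\Omega$ $$\|A_k(\omega)\|>\rho(\delta_0)\quad\text{and}\quad |s_k(\omega)-u_k(\omega)|>\delta_0 .$$
   Context: $A_n(\omega)=A(T^{n-1}\omega)\cdots A(\omega)$ for $n\ge1$, $A_0(\omega)=I_2$, $A_n(\omega)=[A_{-n}(T^{n}\omega)]^{-1}$ for $n\le-1$. $\mathbb{RP}^1=\mathbb{R}/(\pi\mathbb{Z})$ is the set of lines through the origin of $\mathbb{R}^2$ (identified with angles), $B\cdot\theta$ is the induced action of $B\in\mathrm{SL}(2,\mathbb{R})$, and $\vec v\in\theta$ means $\vec v$ lies on the line $\theta$. For $x\in\mathbb{RP}^1$, $|x|$ denotes the distance of $x$ to $0$ in $\mathbb{R}/(\pi\mathbb{Z})$, i.e. $\min\{|x|,|x-\pi|\}$ for a representative $x\in[0,\pi)$. For $D\in\mathrm{SL}(2,\mathbb{R})$ with $\|D\|>1$, $s(D)\in\mathbb{RP}^1$ denotes the most contracted direction of $D$ (the line spanned by the unit vectors $\vec v$ with $\|D\vec v\|=\|D\|^{-1}$). For $n\ge1$, $s_n(\omega)=s[A_n(\omega)]$ and $u_n(\omega)=s[A_{-n}(\omega)]$. (Since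 $\rho(\delta_0)>1$, and since $\|A_{-k}(\omega)\|=\|A_k(T^{-k}\omega)\|$, these are well defined for $n=k$ under the first condition.) $(T,A)$ is uniformly hyperbolic if there are maps $u,s:\Omega\to\mathbb{RP}^1$ (no regularity required) such that (1) $A(\omega)\cdot u(\omega)=u(T\omega)$ and $A(\omega)\cdot s(\omega)=s(T\omega)$ for all $\omega\in\Omega$; (2) there exist $C>0$, $\lambda>1$ such that $\|A_{-n}(\omega)\vec v\|\le C\lambda^{-n}$ and $\|A_n(\omega)\vec w\|\le C\lambda^{-n}$ for all $n\ge1$, all $\omega\in\Omega$ and all unit vectors $\vec v\in u(\omega)$, $\vec w\in s(\omega)$. *)

theory Defs
  imports "HOL-Analysis.Analysis"
begin

definition angle_rel :: "real \<Rightarrow> real \<Rightarrow> bool" where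
  "angle_rel x y \<longleftrightarrow> (\<exists>k::int. x - y = of_int k * pi)"

lemma equivp_angle_rel: "equivp angle_rel"
proof (rule equivpI)
  show "reflp angle_rel"
    by (auto simp: reflp_def angle_rel_def intro: exI[of _ 0])
  show "symp angle_rel"
  proof (rule sympI)
    fix x y assume "angle_rel x y"
    then obtain k :: int where "x - y = of_int k * pi" unfolding angle_rel_def by blast
    then have "y - x = of_int (- k) * pi" by simp
    then show "angle_rel y x" unfolding angle_rel_def by blast
  qed
  show "transp angle_rel"
  proof (rule transpI)
    fix x y z assume "angle_rel x y" "angle_rel y z"
    then obtain k l :: int where "x - y = of_int k * pi" "y - z = of_int l * pi"
      unfolding angle_rel_def by blast
    then have "x - z = of_int (k + l) * pi" by (simp add: algebra_simps)
    then show "angle_rel x z" unfolding angle_rel_def by blast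
  qed
qed

quotient_type rp1 = real / angle_rel
  morphisms rep_rp1 angle
  by (rule equivp_angle_rel)

instantiation rp1 :: ab_group_add
begin

lift_definition zero_rp1 :: rp1 is "0 :: real" .

lift_definition plus_rp1 :: "rp1 \<Rightarrow> rp1 \<Rightarrow> rp1" is "(+) :: real \<Rightarrow> real \<Rightarrow> real"
proof -
  fix a b c d :: real
  assume "angle_rel a b" "angle_rel c d"
  then obtain k l :: int where "a - b = of_int k * pi" "c - d = of_int l * pi"
    unfolding angle_rel_def by blast
  then have "(a + c) - (b + d) = of_int (k + l) * pi" by (simp add: algebra_simps)
  then show "angle_rel (a + c) (b + d)" unfolding angle_rel_def by blast
qed

lift_definition uminus_rp1 :: "rp1 \<Rightarrow> rp1" is "uminus :: real \<Rightarrow> real"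
proof -
  fix a b :: real
  assume "angle_rel a b"
  then obtain k :: int where "a - b = of_int k * pi" unfolding angle_rel_def by blast
  then have "- a - (- b) = of_int (- k) * pi" by simp
  then show "angle_rel (- a) (- b)" unfolding angle_rel_def by blast
qed

lift_definition minus_rp1 :: "rp1 \<Rightarrow> rp1 \<Rightarrow> rp1" is "(-) :: real \<Rightarrow> real \<Rightarrow> real"
proof -
  fix a b c d :: real
  assume "angle_rel a b" "angle_rel c d"
  then obtain k l :: int where "a - b = of_int k * pi" "c - d = of_int l * pi"
    unfolding angle_rel_def by blast
  then have "(a - c) - (b - d) = of_int (k - l) * pi" by (simp add: algebra_simps)
  then show "angle_rel (a - c) (b - d)" unfolding angle_rel_def by blast
qed

instance
  by standard
    (transfer, simp add: algebra_simps, metis equivp_angle_rel equivp_reflp)+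

end

definition rp1_abs :: "rp1 \<Rightarrow> real" where
  "rp1_abs \<theta> = (let x = (THE x. 0 \<le> x \<and> x < pi \<and> angle x = \<theta>) in min \<bar>x\<bar> \<bar>x - pi\<bar>)"

lift_definition line :: "rp1 \<Rightarrow> (real^2) set" is
  "\<lambda>x. span {vector [cos x, sin x] :: real^2}"
proof -
  fix x y :: real
  assume "angle_rel x y"
  then obtain k :: int where "x = y + of_int k * pi"
    unfolding angle_rel_def by (metis add.commute diff_add_cancel)
  then have xy: "x = y + pi * of_int k" by (simp add: mult.commute)
  define c :: real where "c = cos (pi * of_int k)"
  have c: "c \<noteq> 0" unfolding c_def by (simp add: cos_npi_int)
  have "(vector [cos x, sin x] :: real^2) = c *\<^sub>R vector [cos y, sin y]"
    by (simp add: vec_eq_iff forall_2 xy cos_add sin_add c_def)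
  then show "span {vector [cos x, sin x] :: real^2} = span {vector [cos y, sin y]}"
    using span_image_scale[of "{vector [cos y, sin y] :: real^2}" "\<lambda>_. c"] c by simp
qed

definition SL2 :: "(real^2^2) set" where
  "SL2 = {B. det B = 1}"

text \<open>The operator norm; the library's \<^const>\<open>norm\<close> on matrices is the Frobenius norm.\<close>

definition opnorm :: "real^2^2 \<Rightarrow> real" where
  "opnorm B = onorm (\<lambda>v. B *v v)"

text \<open>Meaningful for invertible \<open>B\<close>, which maps lines to lines.\<close>

definition rp1_act :: "real^2^2 \<Rightarrow> rp1 \<Rightarrow> rp1" where
  "rp1_act B \<theta> = (THE \<eta>. line \<eta> = (\<lambda>v. B *v v) ` line \<theta>)"

text \<open>Meaningful for \<open>D\<close> in \<^const>\<open>SL2\<close> with \<open>opnorm D > 1\<close>; then the minimising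
  unit vectors form one antipodal pair.\<close>

definition contracted_dir :: "real^2^2 \<Rightarrow> rp1" where
  "contracted_dir D =
     (THE \<theta>. line \<theta> = span {v. norm v = 1 \<and> norm (D *v v) = inverse (opnorm D)})"

definition iter_int :: "'a topology \<Rightarrow> ('a \<Rightarrow> 'a) \<Rightarrow> int \<Rightarrow> 'a \<Rightarrow> 'a" where
  "iter_int X T n =
     (if n \<ge> 0 then T ^^ nat n else inv_into (topspace X) T ^^ nat (- n))"

primrec cocycle_nat :: "('a \<Rightarrow> 'a) \<Rightarrow> ('a \<Rightarrow> real^2^2) \<Rightarrow> nat \<Rightarrow> 'a \<Rightarrow> real^2^2" where
  "cocycle_nat T A 0 \<omega> = mat 1"
| "cocycle_nat T A (Suc n) \<omega> = A ((T ^^ n) \<omega>) ** cocycle_nat T A n \<omega>"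

definition cocycle ::
  "'a topology \<Rightarrow> ('a \<Rightarrow> 'a) \<Rightarrow> ('a \<Rightarrow> real^2^2) \<Rightarrow> int \<Rightarrow> 'a \<Rightarrow> real^2^2" where
  "cocycle X T A n \<omega> =
     (if n \<ge> 0 then cocycle_nat T A (nat n) \<omega>
      else matrix_inv (cocycle_nat T A (nat (- n)) (iter_int X T n \<omega>)))"

definition s_dir :: "'a topology \<Rightarrow> ('a \<Rightarrow> 'a) \<Rightarrow> ('a \<Rightarrow> real^2^2) \<Rightarrow> nat \<Rightarrow> 'a \<Rightarrow> rp1" where
  "s_dir X T A n \<omega> = contracted_dir (cocycle X T A (int n) \<omega>)"

definition u_dir :: "'a topology \<Rightarrow> ('a \<Rightarrow> 'a) \<Rightarrow> ('a \<Rightarrow> real^2^2) \<Rightarrow> nat \<Rightarrow> 'a \<Rightarrow> rp1" where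
  "u_dir X T A n \<omega> = contracted_dir (cocycle X T A (- int n) \<omega>)"

definition uniformly_hyperbolic ::
  "'a topology \<Rightarrow> ('a \<Rightarrow> 'a) \<Rightarrow> ('a \<Rightarrow> real^2^2) \<Rightarrow> bool" where
  "uniformly_hyperbolic X T A \<longleftrightarrow>
     (\<exists>u s :: 'a \<Rightarrow> rp1.
        (\<forall>\<omega>\<in>topspace X. rp1_act (A \<omega>) (u \<omega>) = u (T \<omega>) \<and> rp1_act (A \<omega>) (s \<omega>) = s (T \<omega>)) \<and>
        (\<exists>C \<mu> :: real. C > 0 \<and> \<mu> > 1 \<and>
           (\<forall>n::nat. n \<ge> 1 \<longrightarrow> (\<forall>\<omega>\<in>topspace X.
              (\<forall>v\<in>line (u \<omega>). norm v = 1 \<longrightarrow>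
                 norm (cocycle X T A (- int n) \<omega> *v v) \<le> C * \<mu> powi (- int n)) \<and>
              (\<forall>w\<in>line (s \<omega>). norm w = 1 \<longrightarrow>
                 norm (cocycle X T A (int n) \<omega> *v w) \<le> C * \<mu> powi (- int n))))))"

definition \<rho> :: "real \<Rightarrow> real" where
  "\<rho> \<delta> = (\<delta> + 3 / \<delta>) * (\<delta> / 2 + 1)"

end

theory Submission
  imports Defs
begin

text \<open>For the ``if'' direction, the cone of half-width \<open>\<delta>\<^sub>0 / 2\<close> around the contracted direction of
  \<open>A\<^sub>k(T\<^sup>k \<omega>)\<close> is mapped by \<open>A\<^sub>k(\<omega>)\<close>'s inverse into the cone around \<open>s\<^sub>k(\<omega>)\<close>, with expansion at least
  \<open>\<rho> \<delta>\<^sub>0 * sin (\<delta>\<^sub>0 / 2) > 1\<close>. Intersecting the pulled back cones along an orbit gives an exponentially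
  contracted vector; it is unique up to scaling because the determinant is 1, hence invariant under
  \<open>A\<close> and not only under \<open>A\<^sub>k\<close>. The unstable direction is the stable one of the inverse cocycle.

  For the ``only if'' direction, a vector contracted by \<open>A\<^sub>n\<close> is close to \<open>s\<^sub>n\<close>, since
  \<open>\<parallel>A\<^sub>n v\<parallel>\<close> dominates \<open>\<parallel>A\<^sub>n\<parallel>\<close> times the sine of the angle between \<open>v\<close> and \<open>s\<^sub>n\<close>. So
  \<open>s\<^sub>n\<close> and \<open>u\<^sub>n\<close> converge uniformly to \<open>s\<close> and \<open>u\<close>, which are uniformly apart as \<open>\<parallel>A\<parallel>\<close> is bounded.\<close>

subsection \<open>Lines and angles in the plane\<close>

text \<open>The determinant of the matrix with columns \<open>x\<close> and \<open>y\<close>, a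
  signed area.\<close>

definition cross :: "real^2 \<Rightarrow> real^2 \<Rightarrow> real" where
  "cross x y = x $ 1 * y $ 2 - x $ 2 * y $ 1"

lemma norm_sq_2: "(norm v)\<^sup>2 = (v $ 1)\<^sup>2 + (v $ 2)\<^sup>2" for v :: "real^2"
  unfolding power2_norm_eq_inner inner_vec_def sum_2 by (simp add: power2_eq_square)

text \<open>Lagrange's identity.\<close>

lemma cross_inner: "(cross x y)\<^sup>2 + (x \<bullet> y)\<^sup>2 = (norm x)\<^sup>2 * (norm y)\<^sup>2"
  unfolding norm_sq_2 cross_def by (simp add: inner_vec_def sum_2 power2_eq_square algebra_simps)

lemma cross_le: "\<bar>cross x y\<bar> \<le> norm x * norm y"
proof -
  have "(cross x y)\<^sup>2 \<le> (norm x * norm y)\<^sup>2"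
    using cross_inner[of x y] zero_le_power2[of "x \<bullet> y"] unfolding power_mult_distrib by linarith
  then show ?thesis by (simp add: abs_le_square_iff[symmetric])
qed

lemma cross_matrix: "cross (D *v x) (D *v y) = det D * cross x y"
  by (simp add: cross_def matrix_vector_mult_def sum_2 det_2 algebra_simps)

text \<open>When \<open>cross\<close> vanishes, each vector equals its orthogonal projection onto
  the other.\<close>

lemma cross_eq_0_span:
  assumes "cross x y = 0" "x \<noteq> 0" "y \<noteq> 0"
  shows "span {x} = span {y}"
proof -
  have key: "y \<in> span {x}" if "cross x y = 0" "x \<noteq> 0" for x y :: "real^2"
  proof -
    have "((norm x)\<^sup>2) *\<^sub>R y = (x \<bullet> y) *\<^sub>R x"
    proof -
      have "x $ 1 * y $ 2 = x $ 2 * y $ 1" using that(1) by (simp add: cross_def)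
      then have "((x $ 1)\<^sup>2 + (x $ 2)\<^sup>2) * y $ 1 = (x $ 1 * y $ 1 + x $ 2 * y $ 2) * x $ 1"
        "((x $ 1)\<^sup>2 + (x $ 2)\<^sup>2) * y $ 2 = (x $ 1 * y $ 1 + x $ 2 * y $ 2) * x $ 2"
        by algebra+
      then show ?thesis
        unfolding norm_sq_2 vec_eq_iff forall_2 inner_vec_def sum_2 vector_scaleR_component
          real_scaleR_def inner_real_def by blast
    qed
    then have "y = ((x \<bullet> y) / (norm x)\<^sup>2) *\<^sub>R x"
      using that(2) by (metis (no_types, lifting) divide_inverse_commute eq_vector_fraction_iff
          norm_eq_zero power_eq_0_iff scaleR_scaleR vector_fraction_eq_iff)
    then show ?thesis by (metis span_base span_scale insertI1)
  qed
  have "cross y x = 0" using assms(1) by (simp add: cross_def mult.commute)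
  then have "x \<in> span {y}" "y \<in> span {x}" using key assms by blast+
  then show ?thesis by (simp add: span_eq)
qed

lemma ex_polar: "\<exists>x. v = norm v *\<^sub>R (vector [cos x, sin x] :: real^2)"
proof (cases "v = 0")
  case False
  then have n: "norm v \<noteq> 0" by simp
  have "(v $ 1 / norm v)\<^sup>2 + (v $ 2 / norm v)\<^sup>2 = ((v $ 1)\<^sup>2 + (v $ 2)\<^sup>2) / (norm v)\<^sup>2"
    by (simp only: power_divide add_divide_distrib)
  also have "\<dots> = 1" using n unfolding norm_sq_2[symmetric] by simp
  finally have "(v $ 1 / norm v)\<^sup>2 + (v $ 2 / norm v)\<^sup>2 = 1" .
  then obtain x where "v $ 1 / norm v = cos x" "v $ 2 / norm v = sin x"
    using sincos_total_2pi by metis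
  then have "v $ 1 = norm v * cos x" "v $ 2 = norm v * sin x"
    using n by (metis nonzero_divide_eq_eq mult.commute)+
  then have "v = norm v *\<^sub>R (vector [cos x, sin x] :: real^2)"
    unfolding vec_eq_iff forall_2 vector_scaleR_component vector_2 real_scaleR_def by blast
  then show ?thesis ..
qed simp

lemma norm_vector_cos_sin: "norm (vector [cos x, sin x] :: real^2) = 1"
proof -
  have "(norm (vector [cos x, sin x] :: real^2))\<^sup>2 = 1" unfolding norm_sq_2 by simp
  then show ?thesis by (simp add: power2_eq_1_iff) (smt (verit) norm_ge_zero)
qed

lemma span_eq_line: assumes "v \<noteq> 0" shows "\<exists>\<theta>. line \<theta> = span {v}"
proof -
  obtain x where x: "v = norm v *\<^sub>R (vector [cos x, sin x] :: real^2)" using ex_polar by blast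
  have "line (angle x) = span {vector [cos x, sin x]}" by (simp add: line.abs_eq)
  also have "\<dots> = span {v}"
    using span_image_scale[of "{vector [cos x, sin x] :: real^2}" "\<lambda>_. norm v"] assms x by simp
  finally show ?thesis by blast
qed

lemma line_eq_span_unit: "\<exists>v. norm v = 1 \<and> line \<theta> = span {v}"
proof -
  obtain x where "\<theta> = angle x" by (metis Quotient_rp1 Quotient_abs_rep)
  then show ?thesis using norm_vector_cos_sin line.abs_eq by metis
qed

lemma unit_vector_in_line: "\<exists>v. v \<in> line \<theta> \<and> norm v = 1"
  using line_eq_span_unit[of \<theta>] span_base by blast

lemma line_eq_span: "v \<in> line \<theta> \<Longrightarrow> v \<noteq> 0 \<Longrightarrow> line \<theta> = span {v}"
proof -
  assume v: "v \<in> line \<theta>" "v \<noteq> 0"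
  obtain w where w: "line \<theta> = span {w}" using line_eq_span_unit by blast
  then obtain c where "v = c *\<^sub>R w" using v(1) by (auto simp: span_singleton)
  then show ?thesis using v(2) w span_image_scale[of "{w}" "\<lambda>_. c"] by auto
qed

lemma scaleR_in_line: "v \<in> line \<theta> \<Longrightarrow> c *\<^sub>R v \<in> line \<theta>"
  using line_eq_span_unit span_scale by metis

section \<open>The distance on the projective line and its sine\<close>

lemma angle_eq_iff: "angle x = angle y \<longleftrightarrow> (\<exists>k::int. x = y + of_int k * pi)"
  unfolding rp1.abs_eq_iff angle_rel_def by (metis add.commute diff_add_cancel add_diff_cancel_right')

text \<open>Trades the definite description in \<open>rp1_abs\<close> for a representative found by
  subtracting a floor multiple of \<open>pi\<close>.\<close>

lemma rp1_abs_rep: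
  obtains r where "0 \<le> r" "r < pi" "\<theta> = angle r" "rp1_abs \<theta> = min r (pi - r)"
proof -
  obtain x where x: "\<theta> = angle x" by (metis Quotient_rp1 Quotient_abs_rep)
  define r where "r = x - of_int \<lfloor>x / pi\<rfloor> * pi"
  have r: "0 \<le> r" "r < pi"
    using floor_divide_lower[of pi x] floor_divide_upper[of pi x] by (auto simp: r_def algebra_simps)
  have a: "\<theta> = angle r" unfolding x angle_eq_iff r_def by auto
  have "(THE y. 0 \<le> y \<and> y < pi \<and> angle y = \<theta>) = r"
  proof (rule the_equality)
    fix y assume y: "0 \<le> y \<and> y < pi \<and> angle y = \<theta>"
    then obtain k :: int where k: "y = r + of_int k * pi" using a angle_eq_iff by metis
    have "of_int k * pi < 1 * pi" "(-1) * pi < of_int k * pi" using k y r by linarith+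
    then have "real_of_int k < 1" "-1 < real_of_int k"
      by (simp_all only: mult_less_cancel_right_pos[OF pi_gt_zero])
    then have "k = 0" by linarith
    then show "y = r" using k by simp
  qed (use r a in auto)
  then have "rp1_abs \<theta> = min r (pi - r)" using r by (simp add: rp1_abs_def)
  then show thesis using that r a by blast
qed

lemma rp1_abs_bounds: "0 \<le> rp1_abs \<theta>" "rp1_abs \<theta> \<le> pi / 2"
  by (rule rp1_abs_rep[of \<theta>], auto simp: min_def)+

lemma sin_add_int_pi: "\<bar>sin (x + of_int k * pi)\<bar> = \<bar>sin x\<bar>"
  by (simp add: sin_add mult.commute[of _ pi] abs_mult cos_npi_int)

text \<open>The sine does not distinguish \<open>r\<close> from \<open>pi - r\<close>, so the
  minimum disappears.\<close>

lemma sin_rp1_abs: "sin (rp1_abs (angle x)) = \<bar>sin x\<bar>"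
proof -
  obtain r where r: "0 \<le> r" "r < pi" "angle x = angle r" "rp1_abs (angle x) = min r (pi - r)"
    by (rule rp1_abs_rep)
  have "\<bar>sin x\<bar> = \<bar>sin r\<bar>" using r(3) sin_add_int_pi unfolding angle_eq_iff by metis
  also have "\<dots> = sin r" using sin_ge_zero[of r] r by simp
  finally show ?thesis using r(4) by (simp add: min_def)
qed

text \<open>Together with \<open>rp1_abs_attained\<close>, this makes the distance a minimum over
  all representatives, which reduces the triangle inequality to the real one.\<close>

lemma rp1_abs_le: "rp1_abs (angle x) \<le> \<bar>x\<bar>"
proof -
  obtain r where r: "0 \<le> r" "r < pi" "angle x = angle r" "rp1_abs (angle x) = min r (pi - r)"
    by (rule rp1_abs_rep)
  obtain k :: int where k: "x = r + of_int k * pi" using r(3) angle_eq_iff by blast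
  show ?thesis
  proof (cases "k \<ge> 0")
    case True
    then have "0 \<le> of_int k * pi" by simp
    then show ?thesis using r k by simp
  next
    case False
    then have "real_of_int k \<le> -1" by linarith
    then have "of_int k * pi \<le> (-1) * pi" by (intro mult_right_mono) auto
    then show ?thesis using r k by simp
  qed
qed

lemma rp1_abs_attained: "\<exists>x. \<theta> = angle x \<and> rp1_abs \<theta> = \<bar>x\<bar>"
proof -
  obtain r where r: "0 \<le> r" "r < pi" "\<theta> = angle r" "rp1_abs \<theta> = min r (pi - r)"
    by (rule rp1_abs_rep)
  have "angle (r - pi) = angle r" unfolding angle_eq_iff by (rule exI[of _ "-1"]) simp
  then show ?thesis using r by (cases "r \<le> pi - r") (auto simp: min_def intro: exI[of _ r] exI[of _ "r - pi"])
qed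

lemma rp1_abs_triangle: "rp1_abs (\<theta> + \<eta>) \<le> rp1_abs \<theta> + rp1_abs \<eta>"
proof -
  obtain x y where "\<theta> = angle x" "rp1_abs \<theta> = \<bar>x\<bar>" "\<eta> = angle y" "rp1_abs \<eta> = \<bar>y\<bar>"
    using rp1_abs_attained by metis
  then show ?thesis using rp1_abs_le[of "x + y"] by (simp add: plus_rp1.abs_eq)
qed

lemma rp1_abs_minus: "rp1_abs (\<theta> - \<eta>) = rp1_abs (\<eta> - \<theta>)"
proof -
  have "rp1_abs (- \<theta>) \<le> rp1_abs \<theta>" for \<theta>
  proof -
    obtain x where "\<theta> = angle x" "rp1_abs \<theta> = \<bar>x\<bar>" using rp1_abs_attained by metis
    then show ?thesis using rp1_abs_le[of "-x"] by (simp add: uminus_rp1.abs_eq)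
  qed
  from this[of "\<theta> - \<eta>"] this[of "\<eta> - \<theta>"] show ?thesis by simp
qed

text \<open>Addition theorem with cosines bounded by 1. It chains estimates known only for sines
  without inverting the sine.\<close>

lemma sin_rp1_abs_triangle:
  "sin (rp1_abs (\<theta> + \<eta>)) \<le> sin (rp1_abs \<theta>) + sin (rp1_abs \<eta>)"
proof -
  obtain x y where "\<theta> = angle x" "\<eta> = angle y" using rp1_abs_attained by metis
  moreover have "\<bar>sin (x + y)\<bar> \<le> \<bar>sin x\<bar> + \<bar>sin y\<bar>"
  proof -
    have "\<bar>sin (x + y)\<bar> \<le> \<bar>sin x\<bar> * \<bar>cos y\<bar> + \<bar>cos x\<bar> * \<bar>sin y\<bar>"
      unfolding sin_add using abs_triangle_ineq[of "sin x * cos y" "cos x * sin y"]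
      by (simp add: abs_mult)
    also have "\<dots> \<le> \<bar>sin x\<bar> * 1 + 1 * \<bar>sin y\<bar>"
      by (intro add_mono mult_mono) auto
    finally show ?thesis by simp
  qed
  ultimately show ?thesis by (simp add: plus_rp1.abs_eq sin_rp1_abs)
qed

text \<open>The link between matrices and angles: bounds on \<open>cross\<close> become bounds on
  distances of lines.\<close>

lemma cross_lines:
  assumes "v \<in> line \<theta>" "w \<in> line \<eta>"
  shows "\<bar>cross v w\<bar> = norm v * norm w * sin (rp1_abs (\<theta> - \<eta>))"
proof -
  obtain x y where xy: "\<theta> = angle x" "\<eta> = angle y" using rp1_abs_attained by metis
  obtain a b where ab: "v = a *\<^sub>R vector [cos x, sin x]" "w = b *\<^sub>R vector [cos y, sin y]"
    using assms xy by (auto simp: line.abs_eq span_singleton)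
  have "cross v w = a * b * (- sin (x - y))"
    unfolding ab cross_def by (simp add: sin_diff algebra_simps)
  then show ?thesis
    unfolding xy by (simp add: minus_rp1.abs_eq sin_rp1_abs ab norm_vector_cos_sin abs_mult)
qed

text \<open>\<open>cross v v\<close> is 0, so the distance, which is at most \<open>pi / 2\<close>,
  has sine 0. This gives uniqueness in the definite descriptions of \<open>rp1_act\<close> and
  \<open>contracted_dir\<close>.\<close>

lemma line_inject: assumes "line \<theta> = line \<eta>" shows "\<theta> = \<eta>"
proof -
  obtain v where v: "norm v = 1" "v \<in> line \<theta>" using unit_vector_in_line by blast
  have "\<bar>cross v v\<bar> = sin (rp1_abs (\<theta> - \<eta>))" using cross_lines[of v \<theta> v \<eta>] v assms by simp
  then have "sin (rp1_abs (\<theta> - \<eta>)) = 0" by (simp add: cross_def)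
  then have "rp1_abs (\<theta> - \<eta>) = 0"
    using sin_gt_zero[of "rp1_abs (\<theta> - \<eta>)"] rp1_abs_bounds[of "\<theta> - \<eta>"] pi_gt_zero
    by (smt (verit) field_sum_of_halves)
  then have "\<theta> - \<eta> = angle 0" using rp1_abs_attained by (metis abs_eq_0)
  then show ?thesis by (simp add: zero_rp1.abs_eq[symmetric])
qed

subsection \<open>Unimodular matrices and their singular values\<close>

lemma det_1_imp_inverse:
  fixes D :: "real^2^2"
  assumes "det D = 1"
  shows "D ** matrix_inv D = mat 1" "matrix_inv D ** D = mat 1"
proof -
  have "invertible D" using assms by (simp add: invertible_det_nz)
  then have "\<exists>D'. D ** D' = mat 1 \<and> D' ** D = mat 1" by (simp add: invertible_def)
  from someI_ex[OF this] show "D ** matrix_inv D = mat 1" "matrix_inv D ** D = mat 1"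
    by (auto simp: matrix_inv_def)
qed

lemma matrix_inv_vec:
  fixes D :: "real^2^2"
  assumes "det D = 1"
  shows "D *v (matrix_inv D *v x) = x" "matrix_inv D *v (D *v x) = x"
  using det_1_imp_inverse[OF assms] by (simp_all add: matrix_vector_mul_assoc)

lemma matrix_inv_eqI:
  fixes D :: "real^2^2"
  assumes "det D = 1" "E ** D = mat 1"
  shows "matrix_inv D = E"
  using det_1_imp_inverse[OF assms(1)] assms(2)
  by (metis matrix_mul_assoc matrix_mul_lid matrix_mul_rid)

lemma det_matrix_inv:
  fixes D :: "real^2^2"
  assumes "det D = 1"
  shows "det (matrix_inv D) = 1"
  using det_1_imp_inverse(1)[OF assms] assms by (metis det_I det_mul mult_1)

lemma matrix_inv_matrix_inv:
  fixes D :: "real^2^2"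
  assumes "det D = 1"
  shows "matrix_inv (matrix_inv D) = D"
  by (rule matrix_inv_eqI) (use assms det_matrix_inv det_1_imp_inverse in auto)

lemma matrix_inv_mult:
  fixes D E :: "real^2^2"
  assumes "det D = 1" "det E = 1"
  shows "matrix_inv (D ** E) = matrix_inv E ** matrix_inv D"
proof (rule matrix_inv_eqI)
  have "(matrix_inv E ** matrix_inv D) ** (D ** E) = matrix_inv E ** (matrix_inv D ** D) ** E"
    by (simp add: matrix_mul_assoc)
  then show "(matrix_inv E ** matrix_inv D) ** (D ** E) = mat 1"
    using assms by (simp add: det_1_imp_inverse)
qed (use assms in \<open>simp add: det_mul\<close>)

lemma image_line:
  assumes "det D = 1" "v \<in> line \<theta>" "v \<noteq> 0"
  shows "(\<lambda>v. D *v v) ` line \<theta> = span {D *v v}" "D *v v \<noteq> 0"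
proof -
  show "(\<lambda>v. D *v v) ` line \<theta> = span {D *v v}"
    using line_eq_span[OF assms(2,3)]
    by (auto simp: span_singleton image_image matrix_vector_mult_scaleR)
  show "D *v v \<noteq> 0" using matrix_inv_vec(2)[OF assms(1), of v] assms(3) by auto
qed

lemma rp1_act_eq_iff:
  assumes "det D = 1"
  shows "rp1_act D \<theta> = \<eta> \<longleftrightarrow> line \<eta> = (\<lambda>v. D *v v) ` line \<theta>"
proof -
  obtain v where v: "norm v = 1" "v \<in> line \<theta>" using unit_vector_in_line by blast
  then have "\<exists>\<eta>. line \<eta> = (\<lambda>v. D *v v) ` line \<theta>"
    using image_line[OF assms, of v \<theta>] span_eq_line[of "D *v v"] by force
  then obtain \<zeta> where z: "line \<zeta> = (\<lambda>v. D *v v) ` line \<theta>" by blast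
  then have "rp1_act D \<theta> = \<zeta>"
    unfolding rp1_act_def using line_inject by (intro the_equality) auto
  then show ?thesis using z line_inject by metis
qed

section \<open>The operator norm\<close>

lemma norm_le_opnorm: "norm (D *v v) \<le> opnorm D * norm v"
  unfolding opnorm_def by (rule onorm[OF matrix_vector_mul_bounded_linear])

lemma opnorm_nonneg: "0 \<le> opnorm D"
  unfolding opnorm_def by (rule onorm_pos_le[OF matrix_vector_mul_bounded_linear])

lemma opnorm_leI: "(\<And>v. norm (D *v v) \<le> b * norm v) \<Longrightarrow> opnorm D \<le> b"
  unfolding opnorm_def by (rule onorm_le)

lemma opnorm_mult: "opnorm (D ** E) \<le> opnorm D * opnorm E"
proof (rule opnorm_leI)
  fix v
  have "norm ((D ** E) *v v) \<le> opnorm D * norm (E *v v)"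
    using norm_le_opnorm[of D "E *v v"] by (simp add: matrix_vector_mul_assoc)
  also have "\<dots> \<le> opnorm D * (opnorm E * norm v)"
    by (intro mult_left_mono norm_le_opnorm opnorm_nonneg)
  finally show "norm ((D ** E) *v v) \<le> opnorm D * opnorm E * norm v" by simp
qed

lemma continuous_on_matrix_vec: "continuous_on S (\<lambda>v. D *v v)" for D :: "real^2^2"
  by (rule linear_continuous_on[OF matrix_vector_mul_bounded_linear])

lemma opnorm_attained: "\<exists>m. norm m = 1 \<and> norm (D *v m) = opnorm D"
proof -
  have "sphere (0::real^2) 1 \<noteq> {}" by simp
  moreover have "continuous_on (sphere (0::real^2) 1) (\<lambda>v. norm (D *v v))"
    by (intro continuous_on_norm continuous_on_matrix_vec)
  ultimately obtain m where m: "m \<in> sphere (0::real^2) 1"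
    "\<forall>v\<in>sphere 0 1. norm (D *v v) \<le> norm (D *v m)"
    using continuous_attains_sup[OF compact_sphere] by blast
  have "opnorm D \<le> norm (D *v m)"
  proof (rule opnorm_leI)
    fix v :: "real^2"
    show "norm (D *v v) \<le> norm (D *v m) * norm v"
    proof (cases "v = 0")
      case False
      have "v = norm v *\<^sub>R ((1 / norm v) *\<^sub>R v)" using False by simp
      then have "D *v v = norm v *\<^sub>R (D *v ((1 / norm v) *\<^sub>R v))"
        by (metis matrix_vector_mult_scaleR)
      then have "norm (D *v v) = norm v * norm (D *v ((1 / norm v) *\<^sub>R v))" by (metis abs_norm_cancel norm_scaleR)
      also have "\<dots> \<le> norm v * norm (D *v m)"
        using m(2) False by (intro mult_left_mono) auto
      finally show ?thesis by (simp add: mult.commute)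
    qed simp
  qed
  moreover have "norm (D *v m) \<le> opnorm D" using norm_le_opnorm[of D m] m(1) by simp
  ultimately show ?thesis using m(1) by (intro exI[of _ m]) simp
qed

text \<open>The unit square is mapped to a parallelogram of area 1 whose sides have length at most
  \<open>opnorm D\<close>.\<close>

lemma opnorm_ge_1: assumes "det D = 1" shows "1 \<le> opnorm D"
proof -
  define e :: "real^2" where "e = vector [1, 0]"
  define f :: "real^2" where "f = vector [0, 1]"
  have n: "norm e = 1" "norm f = 1"
    using norm_vector_cos_sin[of 0] norm_vector_cos_sin[of "pi / 2"] by (simp_all add: e_def f_def)
  have "1 = \<bar>cross (D *v e) (D *v f)\<bar>"
    unfolding cross_matrix assms by (simp add: cross_def e_def f_def)
  also have "\<dots> \<le> norm (D *v e) * norm (D *v f)" by (rule cross_le)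
  also have "\<dots> \<le> opnorm D * opnorm D"
    using norm_le_opnorm[of D e] norm_le_opnorm[of D f] n by (intro mult_mono) (auto simp: opnorm_nonneg)
  finally have "1\<^sup>2 \<le> (opnorm D)\<^sup>2" by (simp add: power2_eq_square)
  then show ?thesis by (rule power2_le_imp_le) (rule opnorm_nonneg)
qed

text \<open>The quarter turn; it completes a unit vector to a positively oriented orthonormal
  basis.\<close>

definition rot :: "real^2 \<Rightarrow> real^2" where
  "rot v = vector [- v $ 2, v $ 1]"

lemma rot_simps [simp]: "rot v $ 1 = - v $ 2" "rot v $ 2 = v $ 1"
  by (simp_all add: rot_def)

text \<open>A most stretched unit vector \<open>m\<close> and its quarter turn \<open>p\<close> have
  orthogonal images, of lengths \<open>opnorm D\<close> and, since area is preserved, its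
  reciprocal. Up to sign, \<open>cross p w\<close> is the coordinate of \<open>w\<close> along
  \<open>m\<close>.\<close>

lemma singular_values:
  assumes "det D = 1"
  obtains p where "norm p = 1"
    "\<And>w. (norm (D *v w))\<^sup>2 = (opnorm D)\<^sup>2 * (cross p w)\<^sup>2 + (w \<bullet> p)\<^sup>2 / (opnorm D)\<^sup>2"
proof -
  obtain m where m: "norm m = 1" "norm (D *v m) = opnorm D" using opnorm_attained by blast
  define p where "p = rot m"
  define N where "N = opnorm D"
  have N: "N \<ge> 1" using opnorm_ge_1[OF assms] by (simp add: N_def)
  have m2: "m $ 1 * m $ 1 + m $ 2 * m $ 2 = 1"
    using norm_sq_2[of m] m(1) by (simp add: power2_eq_square)
  have p: "norm p = 1"
  proof -
    have "(norm p)\<^sup>2 = 1" unfolding norm_sq_2 using m2 by (simp add: p_def power2_eq_square)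
    then show ?thesis by (metis norm_ge_zero power2_eq_1_iff zero_le_one not_one_le_zero neg_0_le_iff_le)
  qed
  \<comment> \<open>\<open>cross w p\<close> is the inner product of \<open>w\<close> and
    \<open>m\<close>, because \<open>p\<close> is \<open>m\<close> turned by a right angle.\<close>
  have dec: "w = cross w p *\<^sub>R m + (w \<bullet> p) *\<^sub>R p" for w
  proof -
    have "w $ 1 = (w $ 1 * m $ 1 + w $ 2 * m $ 2) * m $ 1 + (w $ 1 * - m $ 2 + w $ 2 * m $ 1) * - m $ 2"
      "w $ 2 = (w $ 1 * m $ 1 + w $ 2 * m $ 2) * m $ 2 + (w $ 1 * - m $ 2 + w $ 2 * m $ 1) * m $ 1"
      using m2 by algebra+
    then show ?thesis
      unfolding vec_eq_iff forall_2 by (simp add: cross_def p_def inner_vec_def sum_2)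
  qed
  define a b where "a = D *v m" and "b = D *v p"
  have na: "a \<bullet> a = N\<^sup>2" using m(2) by (simp add: a_def N_def power2_norm_eq_inner[symmetric])
  have quad: "2 * t * (a \<bullet> b) + t\<^sup>2 * (b \<bullet> b) \<le> t\<^sup>2 * N\<^sup>2" for t :: real
  proof -
    have "norm (D *v (m + t *\<^sub>R p)) \<le> N * norm (m + t *\<^sub>R p)"
      unfolding N_def by (rule norm_le_opnorm)
    then have "(norm (D *v (m + t *\<^sub>R p)))\<^sup>2 \<le> (N * norm (m + t *\<^sub>R p))\<^sup>2"
      by (intro power_mono) auto
    moreover have "(norm (m + t *\<^sub>R p))\<^sup>2 = 1 + t\<^sup>2"
      unfolding norm_sq_2 using m2 by (simp add: p_def power2_eq_square) algebra
    moreover have "D *v (m + t *\<^sub>R p) = a + t *\<^sub>R b"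
      by (simp add: a_def b_def matrix_vector_right_distrib matrix_vector_mult_scaleR)
    moreover have "(norm (a + t *\<^sub>R b))\<^sup>2 = N\<^sup>2 + 2 * t * (a \<bullet> b) + t\<^sup>2 * (b \<bullet> b)"
      unfolding power2_norm_eq_inner using na
      by (simp add: inner_add_left inner_add_right inner_commute power2_eq_square algebra_simps)
    ultimately show ?thesis by (simp add: power_mult_distrib algebra_simps)
  qed
  text \<open>Since \<open>m\<close> maximises \<open>norm (D *v m)\<close>, the first-order term of \<open>quad\<close> vanishes.\<close>
  have ab: "a \<bullet> b = 0"
  proof -
    define c where "c = a \<bullet> b"
    \<comment> \<open>With this \<open>t\<close> the linear term is twice the quadratic bound, which
      forces \<open>c = 0\<close>.\<close>
    define t where "t = c / N\<^sup>2"
    have "0 \<le> t\<^sup>2 * (b \<bullet> b)" by simp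
    then have "2 * t * c \<le> t\<^sup>2 * N\<^sup>2" using quad[of t] unfolding c_def by linarith
    then have "2 * (c\<^sup>2 / N\<^sup>2) \<le> c\<^sup>2 / N\<^sup>2"
      using N by (simp add: t_def power2_eq_square)
    then have "c\<^sup>2 / N\<^sup>2 \<le> 0" by linarith
    then have "c = 0" using N by (simp add: divide_le_0_iff)
    then show ?thesis by (simp add: c_def)
  qed
  have nb: "b \<bullet> b = 1 / N\<^sup>2"
  proof -
    have "cross m p = 1" using m2 by (simp add: cross_def p_def)
    then have "cross a b = 1" by (simp add: a_def b_def cross_matrix assms)
    then have "N\<^sup>2 * (b \<bullet> b) = 1"
      using cross_inner[of a b] ab na by (simp add: power2_norm_eq_inner)
    then show ?thesis using N by (simp add: field_simps)
  qed
  have "(norm (D *v w))\<^sup>2 = N\<^sup>2 * (cross p w)\<^sup>2 + (w \<bullet> p)\<^sup>2 / N\<^sup>2" for w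
  proof -
    have "D *v w = cross w p *\<^sub>R a + (w \<bullet> p) *\<^sub>R b"
      unfolding a_def b_def by (subst dec[of w]) (simp only: matrix_vector_right_distrib matrix_vector_mult_scaleR)
    then have "(norm (D *v w))\<^sup>2 = (cross w p)\<^sup>2 * N\<^sup>2 + (w \<bullet> p)\<^sup>2 * (1 / N\<^sup>2)"
      unfolding power2_norm_eq_inner using na nb ab
      by (simp add: inner_add_left inner_add_right inner_commute power2_eq_square algebra_simps)
    moreover have "(cross w p)\<^sup>2 = (cross p w)\<^sup>2"
      by (simp add: cross_def power2_eq_square algebra_simps)
    ultimately show ?thesis by simp
  qed
  then show thesis using that p unfolding N_def by blast
qed

subsection \<open>Contracted directions and invariant cones\<close>

text \<open>\<open>D\<close> shrinks no vector by more than the factor \<open>opnorm D\<close>, so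
  its inverse stretches by at most that; equality follows by exchanging the two matrices.\<close>

lemma opnorm_matrix_inv:
  assumes "det D = 1"
  shows "opnorm (matrix_inv D) = opnorm D"
proof -
  have le: "opnorm (matrix_inv D) \<le> opnorm D" if D: "det D = 1" for D
  proof (rule opnorm_leI)
    fix v
    obtain p where p: "norm p = 1"
      "\<And>w. (norm (D *v w))\<^sup>2 = (opnorm D)\<^sup>2 * (cross p w)\<^sup>2 + (w \<bullet> p)\<^sup>2 / (opnorm D)\<^sup>2"
      using singular_values[OF D] by blast
    define w where "w = matrix_inv D *v v"
    define N where "N = opnorm D"
    have N: "N \<ge> 1" using opnorm_ge_1[OF D] by (simp add: N_def)
    have "1 / N\<^sup>2 \<le> N\<^sup>2"
      using N by (smt (verit) divide_le_eq_1 one_le_power)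
    then have "(cross p w)\<^sup>2 * (1 / N\<^sup>2) \<le> (cross p w)\<^sup>2 * N\<^sup>2"
      by (rule mult_left_mono) simp
    then have "((cross p w)\<^sup>2 + (w \<bullet> p)\<^sup>2) / N\<^sup>2 \<le> (norm (D *v w))\<^sup>2"
      unfolding p(2) N_def[symmetric] by (simp add: add_divide_distrib mult.commute)
    moreover have "(cross p w)\<^sup>2 + (w \<bullet> p)\<^sup>2 = (norm w)\<^sup>2"
      using cross_inner[of p w] p(1) by (simp add: inner_commute)
    moreover have "D *v w = v" by (simp add: w_def matrix_inv_vec[OF D])
    ultimately have "(norm w)\<^sup>2 / N\<^sup>2 \<le> (norm v)\<^sup>2" by simp
    then have "(norm w)\<^sup>2 \<le> (N * norm v)\<^sup>2"
      using N by (simp add: divide_le_eq power_mult_distrib mult.commute)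
    then show "norm w \<le> opnorm D * norm v"
      unfolding N_def[symmetric] by (rule power2_le_imp_le) (use N in simp)
  qed
  have "opnorm D \<le> opnorm (matrix_inv D)"
    using le[OF det_matrix_inv[OF assms]] matrix_inv_matrix_inv[OF assms] by simp
  then show ?thesis using le[OF assms] by simp
qed

text \<open>The component of \<open>w\<close> orthogonal to the contracted direction is stretched by
  exactly \<open>opnorm D\<close>, and the other component only adds to the norm. Most of the proof
  identifies \<open>contracted_dir D\<close> with the line of \<open>p\<close>.\<close>

lemma contracted_dir_bound:
  assumes "det D = 1" "opnorm D > 1" "w \<in> line \<theta>"
  shows "opnorm D * (norm w * sin (rp1_abs (\<theta> - contracted_dir D))) \<le> norm (D *v w)"
proof -
  obtain p where p: "norm p = 1"
    and sv: "\<And>w. (norm (D *v w))\<^sup>2 = (opnorm D)\<^sup>2 * (cross p w)\<^sup>2 + (w \<bullet> p)\<^sup>2 / (opnorm D)\<^sup>2"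
    using singular_values[OF assms(1)] by blast
  define N where "N = opnorm D"
  have N: "N > 1" using assms(2) by (simp add: N_def)
  have min: "norm v = 1 \<and> norm (D *v v) = inverse N \<longleftrightarrow> norm v = 1 \<and> cross p v = 0" for v
  proof (cases "norm v = 1")
    case True
    have "(cross p v)\<^sup>2 + (v \<bullet> p)\<^sup>2 = 1"
      using cross_inner[of p v] p True by (simp add: inner_commute)
    then have ip: "(v \<bullet> p)\<^sup>2 = 1 - (cross p v)\<^sup>2" by simp
    have "norm (D *v v) = inverse N \<longleftrightarrow> (norm (D *v v))\<^sup>2 = (inverse N)\<^sup>2"
      using N by (intro power2_eq_iff_nonneg[symmetric]) auto
    also have "\<dots> \<longleftrightarrow> (N\<^sup>2 - 1 / N\<^sup>2) * (cross p v)\<^sup>2 = 0"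
      unfolding sv ip N_def[symmetric] by (simp add: divide_simps) (auto simp: algebra_simps)
    also have "\<dots> \<longleftrightarrow> cross p v = 0"
    proof -
      \<comment> \<open>Here \<open>N > 1\<close> matters: the coefficient is positive, so only unit
        vectors parallel to \<open>p\<close> are minimisers.\<close>
      have "1 < N\<^sup>2" using N by (simp add: one_less_power)
      then have "1 / N\<^sup>2 < N\<^sup>2" by (smt (verit) divide_less_eq_1)
      then show ?thesis by simp
    qed
    finally show ?thesis by simp
  qed simp
  have "span {v. norm v = 1 \<and> norm (D *v v) = inverse N} = span {p}"
  proof -
    have "{v. norm v = 1 \<and> norm (D *v v) = inverse N} \<subseteq> span {p}"
    proof
      fix v assume "v \<in> {v. norm v = 1 \<and> norm (D *v v) = inverse N}"
      then have "norm v = 1" "cross p v = 0" using min by auto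
      then have "span {p} = span {v}" using p by (intro cross_eq_0_span) auto
      then show "v \<in> span {p}" by (simp add: span_base)
    qed
    moreover have "p \<in> {v. norm v = 1 \<and> norm (D *v v) = inverse N}"
      using min[of p] p by (simp add: cross_def)
    ultimately show ?thesis by (simp add: span_eq span_base)
  qed
  moreover obtain \<eta> where \<eta>: "line \<eta> = span {p}" using span_eq_line[of p] p by force
  ultimately have "contracted_dir D = \<eta>"
    unfolding contracted_dir_def N_def using line_inject by (intro the_equality) auto
  moreover have "p \<in> line \<eta>" using \<eta> by (simp add: span_base)
  ultimately have "\<bar>cross p w\<bar> = norm w * sin (rp1_abs (\<theta> - contracted_dir D))"
    using cross_lines[OF _ assms(3)] p rp1_abs_minus[of \<theta>] by simp
  moreover have "(N * \<bar>cross p w\<bar>)\<^sup>2 \<le> (norm (D *v w))\<^sup>2"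
    unfolding sv N_def[symmetric] by (simp add: power_mult_distrib)
  then have "N * \<bar>cross p w\<bar> \<le> norm (D *v w)" by (rule power2_le_imp_le) simp
  ultimately show ?thesis by (simp add: N_def)
qed

section \<open>The expansion rate and the cones\<close>

lemma \<rho>_gt_1: assumes "\<delta> > 0" shows "\<rho> \<delta> > 1"
proof -
  have "\<rho> \<delta> = \<delta>\<^sup>2 / 2 + \<delta> + 3 / 2 + 3 / \<delta>"
    using assms by (simp add: \<rho>_def field_simps power2_eq_square)
  moreover have "0 < 3 / \<delta>" using assms by simp
  ultimately show ?thesis using assms by (smt (verit) field_sum_of_halves zero_le_power2 divide_nonneg_nonneg)
qed

text \<open>With \<open>x = \<delta> / 2\<close>, the bounds
  \<open>\<rho> \<delta> \<ge> 3 / (2 * x)\<close> and \<open>sin x \<ge> 5 / 6 * x\<close> give a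
  product of at least 5 / 4. This product is the expansion rate of the cone argument.\<close>

lemma \<rho>_sin_gt_1:
  assumes "\<delta> > 0" "\<delta> < pi / 2"
  shows "\<rho> \<delta> * sin (\<delta> / 2) > 1"
proof -
  define x where "x = \<delta> / 2"
  have x: "0 < x" "x < 1" using assms pi_less_4 by (auto simp: x_def)
  \<comment> \<open>Taylor's bound, weakened by \<open>x ^ 3 \<le> x\<close>, yields the factor 5 /
    6.\<close>
  have "\<bar>sin x - x\<bar> \<le> x ^ 3 / 6"
    using Maclaurin_sin_bound[of x 3] x
    by (simp add: numeral_3_eq_3 sin_coeff_def fact_numeral divide_simps)
  moreover have "x ^ 3 \<le> x" using x power_decreasing[of 1 3 x] by simp
  ultimately have sin: "5 / 6 * x \<le> sin x" by linarith
  have "1 < 3 / 2 * (5 / 6 :: real)" by simp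
  also have "\<dots> \<le> 3 / (2 * x) * (5 / 6 * x)" using x by simp
  also have "\<dots> \<le> 3 / (2 * x) * sin x" using x sin by (intro mult_left_mono) auto
  also have "\<dots> \<le> \<rho> \<delta> * sin x"
  proof (rule mult_right_mono)
    have "3 / (2 * x) = 3 / \<delta> * 1" by (simp add: x_def)
    also have "\<dots> \<le> \<rho> \<delta>" unfolding \<rho>_def using assms by (intro mult_mono) auto
    finally show "3 / (2 * x) \<le> \<rho> \<delta>" .
    show "0 \<le> sin x" using sin x by simp
  qed
  finally show ?thesis by (simp add: x_def)
qed

text \<open>\<open>D *v x\<close> is near \<open>s'\<close>, hence at least
  \<open>\<delta> / 2\<close> away from the contracted direction of the inverse, which therefore
  expands it. If \<open>x\<close> lay outside the cone of \<open>D\<close>, then \<open>D\<close>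
  would expand as well, and going forth and back would enlarge \<open>x\<close>.\<close>

lemma cone_step:
  assumes D: "det D = 1" "opnorm D > \<rho> \<delta>" and \<delta>: "0 < \<delta>"
    and sep: "rp1_abs (s' - contracted_dir (matrix_inv D)) > \<delta>"
    and x: "x \<noteq> 0" "D *v x \<in> line \<eta>" "rp1_abs (\<eta> - s') \<le> \<delta> / 2"
  shows "\<exists>\<zeta>. x \<in> line \<zeta> \<and> rp1_abs (\<zeta> - contracted_dir D) \<le> \<delta> / 2"
    and "\<rho> \<delta> * sin (\<delta> / 2) * norm (D *v x) \<le> norm x"
proof -
  define E where "E = matrix_inv D"
  define y where "y = D *v x"
  define N where "N = opnorm D"
  have E: "det E = 1" "opnorm E = N" "E *v y = x"
    using D det_matrix_inv opnorm_matrix_inv matrix_inv_vec by (auto simp: E_def y_def N_def)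
  \<comment> \<open>Distances never exceed \<open>pi / 2\<close>, so the separation itself bounds
    \<open>\<delta>\<close>.\<close>
  have \<delta>2: "\<delta> < pi / 2" using sep rp1_abs_bounds(2) less_le_trans by blast
  have N: "N > \<rho> \<delta>" "N > 1" using D \<rho>_gt_1[OF \<delta>] by (auto simp: N_def)
  have sin0: "0 < sin (\<delta> / 2)" using \<delta> \<delta>2 by (intro sin_gt_zero) auto
  have Ns: "1 < \<rho> \<delta> * sin (\<delta> / 2)" "\<rho> \<delta> * sin (\<delta> / 2) \<le> N * sin (\<delta> / 2)"
    using \<rho>_sin_gt_1[OF \<delta> \<delta>2] N sin0 by (auto intro: mult_right_mono)
  have "rp1_abs (s' - contracted_dir E) \<le> rp1_abs (s' - \<eta>) + rp1_abs (\<eta> - contracted_dir E)"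
    using rp1_abs_triangle[of "s' - \<eta>" "\<eta> - contracted_dir E"] by simp
  then have "\<delta> / 2 \<le> rp1_abs (\<eta> - contracted_dir E)"
    using sep x(3) rp1_abs_minus[of s' \<eta>] by (simp add: E_def)
  then have "sin (\<delta> / 2) \<le> sin (rp1_abs (\<eta> - contracted_dir E))"
    using \<delta> \<delta>2 rp1_abs_bounds(2)[of "\<eta> - contracted_dir E"] by (intro sin_monotone_2pi_le) auto
  then have "N * (norm y * sin (\<delta> / 2)) \<le> N * (norm y * sin (rp1_abs (\<eta> - contracted_dir E)))"
    using N by (intro mult_left_mono) auto
  also have "\<dots> \<le> norm x"
    using contracted_dir_bound[of E y \<eta>] E N x(2) by (simp add: y_def)
  finally have grow: "N * sin (\<delta> / 2) * norm y \<le> norm x" by (simp add: mult_ac)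
  show "\<rho> \<delta> * sin (\<delta> / 2) * norm (D *v x) \<le> norm x"
    using mult_right_mono[OF Ns(2), of "norm y"] grow by (simp add: y_def)
  obtain \<zeta> where \<zeta>: "x \<in> line \<zeta>" using span_eq_line[OF x(1)] span_base by blast
  have "rp1_abs (\<zeta> - contracted_dir D) \<le> \<delta> / 2"
  proof (rule ccontr)
    assume "\<not> ?thesis"
    then have "sin (\<delta> / 2) \<le> sin (rp1_abs (\<zeta> - contracted_dir D))"
      using \<delta> \<delta>2 rp1_abs_bounds(2)[of "\<zeta> - contracted_dir D"] by (intro sin_monotone_2pi_le) auto
    then have "N * (norm x * sin (\<delta> / 2)) \<le> N * (norm x * sin (rp1_abs (\<zeta> - contracted_dir D)))"
      using N by (intro mult_left_mono) auto
    also have "\<dots> \<le> norm y"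
      using contracted_dir_bound[of D x \<zeta>] D N \<zeta> by (simp add: y_def N_def)
    finally have "(N * sin (\<delta> / 2)) * norm x \<le> norm y" by (simp add: mult_ac)
    moreover have "norm x < N * sin (\<delta> / 2) * norm x" using x(1) Ns by simp
    moreover have "norm y \<le> N * sin (\<delta> / 2) * norm y"
      using Ns mult_right_mono[of 1 "N * sin (\<delta> / 2)" "norm y"] by simp
    ultimately show False using grow by simp
  qed
  then show "\<exists>\<zeta>. x \<in> line \<zeta> \<and> rp1_abs (\<zeta> - contracted_dir D) \<le> \<delta> / 2" using \<zeta> by blast
qed

text \<open>For each \<open>n\<close> the unit vectors contracted at the required rate up to time
  \<open>n\<close> form a nonempty compact set, and these sets are nested. A common element is
  contracted for all time.\<close>

lemma stable_vector_exists:
  fixes B P :: "nat \<Rightarrow> real^2^2" and \<delta> :: real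
  defines "r \<equiv> \<rho> \<delta> * sin (\<delta> / 2)"
  assumes B: "\<And>j. det (B j) = 1" "\<And>j. opnorm (B j) > \<rho> \<delta>" and \<delta>: "0 < \<delta>"
    and sep: "\<And>j. rp1_abs (contracted_dir (B (Suc j)) - contracted_dir (matrix_inv (B j))) > \<delta>"
    and P: "P 0 = mat 1" "\<And>n. P (Suc n) = B n ** P n"
  shows "\<exists>v. norm v = 1 \<and> (\<forall>n. norm (P n *v v) \<le> 1 / r ^ n)"
proof -
  have "\<delta> < pi / 2" using sep[of 0] rp1_abs_bounds(2) less_le_trans by blast
  then have r1: "r > 1" unfolding r_def using \<rho>_sin_gt_1 \<delta> by blast
  have detP: "det (P n) = 1" for n by (induction n) (simp_all add: P det_mul B)
  have P_Suc: "P (Suc n) *v x = B n *v (P n *v x)" for n x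
    by (simp add: P matrix_vector_mul_assoc)
  \<comment> \<open>A vector that is in the cone at time \<open>n\<close> was in all earlier cones,
    and each step back multiplies its norm by at least \<open>r\<close>.\<close>
  have contr: "r ^ m * norm (P m *v x) \<le> norm x"
    if "x \<noteq> 0" "\<exists>\<eta>. P n *v x \<in> line \<eta> \<and> rp1_abs (\<eta> - contracted_dir (B n)) \<le> \<delta> / 2" "m \<le> n" for n m x
    using that(2,3)
  proof (induction n arbitrary: m)
    case 0
    then show ?case by (simp add: P)
  next
    case (Suc n)
    then obtain \<eta> where \<eta>: "B n *v (P n *v x) \<in> line \<eta>" "rp1_abs (\<eta> - contracted_dir (B (Suc n))) \<le> \<delta> / 2"
      unfolding P_Suc by blast
    have "P n *v x \<noteq> 0" using matrix_inv_vec(2)[OF detP, of n x] that(1) by auto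
    note step = cone_step[OF B \<delta> sep this \<eta>, folded r_def]
    show ?case
    proof (cases "m = Suc n")
      case True
      have "r ^ n * (r * norm (P (Suc n) *v x)) \<le> r ^ n * norm (P n *v x)"
        using step(2) r1 unfolding P_Suc by (intro mult_left_mono) auto
      also have "\<dots> \<le> norm x" using Suc.IH[OF step(1)] by simp
      finally show ?thesis using True by (simp add: mult_ac)
    qed (use Suc.IH[OF step(1)] Suc.prems in auto)
  qed
  define F where "F n = {v. norm v = 1 \<and> (\<forall>m\<le>n. r ^ m * norm (P m *v v) \<le> 1)}" for n
  have "\<Inter>(range F) \<noteq> {}"
  proof (rule compact_nest)
    fix n
    have "F n = sphere 0 1 \<inter> (\<Inter>m\<in>{..n}. {v. r ^ m * norm (P m *v v) \<le> 1})"
      by (auto simp: F_def)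
    moreover have "closed {v. r ^ m * norm (P m *v v) \<le> 1}" for m
      by (intro closed_Collect_le continuous_intros continuous_on_matrix_vec)
    ultimately show "compact (F n)" by (auto intro!: compact_Int_closed closed_INT)
    obtain p where p: "norm p = 1" "line (contracted_dir (B n)) = span {p}"
      using line_eq_span_unit by blast
    \<comment> \<open>The centre of the cone at time \<open>n\<close>, pulled back to time 0; after
      normalisation it lies in \<open>F n\<close>.\<close>
    define x where "x = matrix_inv (P n) *v p"
    have px: "P n *v x = p" by (simp add: x_def matrix_inv_vec detP)
    then have "x \<noteq> 0" using p(1) by auto
    have "p \<in> line (contracted_dir (B n))" using p(2) by (simp add: span_base)
    moreover have "rp1_abs (contracted_dir (B n) - contracted_dir (B n)) = 0"
      using rp1_abs_le[of 0] rp1_abs_bounds(1) by (simp add: zero_rp1.abs_eq[symmetric] order_antisym)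
    ultimately have "\<exists>\<eta>. P n *v x \<in> line \<eta> \<and> rp1_abs (\<eta> - contracted_dir (B n)) \<le> \<delta> / 2"
      using px \<delta> by (metis half_gt_zero less_imp_le)
    then have "r ^ m * norm (P m *v x) \<le> norm x" if "m \<le> n" for m using contr \<open>x \<noteq> 0\<close> that by blast
    then have "(1 / norm x) *\<^sub>R x \<in> F n"
      using \<open>x \<noteq> 0\<close> by (simp add: F_def matrix_vector_mult_scaleR divide_simps mult.commute)
    then show "F n \<noteq> {}" by blast
  next
    fix m n :: nat assume "m \<le> n"
    then show "F n \<subseteq> F m" by (auto simp: F_def)
  qed
  then obtain v where v: "\<And>n. v \<in> F n" by blast
  have "norm (P n *v v) \<le> 1 / r ^ n" for n
    using v[of n] r1 by (auto simp: F_def pos_le_divide_eq mult.commute)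
  moreover have "norm v = 1" using v[of 0] by (simp add: F_def)
  ultimately show ?thesis by blast
qed

subsection \<open>Cocycles over a bijection\<close>

lemma inverse_powers_tendsto_0:
  fixes \<mu> :: real
  assumes "\<mu> > 1"
  shows "(\<lambda>n. c / \<mu> ^ n) \<longlonglongrightarrow> 0"
proof -
  have "(\<lambda>n. c * (1 / \<mu>) ^ n) \<longlonglongrightarrow> c * 0"
    using assms by (intro tendsto_mult_left LIMSEQ_power_zero) auto
  then show ?thesis by (simp add: power_one_over)
qed

text \<open>Every \<open>P n\<close> preserves the area \<open>cross x y\<close>, which is bounded
  by a product of two lengths tending to 0. This is the uniqueness of the stable direction.\<close>

lemma stable_vectors_parallel:
  fixes P :: "nat \<Rightarrow> real^2^2"
  assumes "\<And>n. det (P n) = 1" "\<mu> > 1"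
    and "\<And>n. n \<ge> 1 \<Longrightarrow> norm (P n *v x) \<le> c / \<mu> ^ n"
    and "\<And>n. n \<ge> 1 \<Longrightarrow> norm (P n *v y) \<le> d / \<mu> ^ n"
  shows "cross x y = 0"
proof -
  have "\<bar>cross x y\<bar> \<le> (c / \<mu> ^ n) * (d / \<mu> ^ n)" if n: "n \<ge> 1" for n
  proof -
    have "\<bar>cross x y\<bar> = \<bar>cross (P n *v x) (P n *v y)\<bar>" by (simp add: cross_matrix assms)
    also have "\<dots> \<le> norm (P n *v x) * norm (P n *v y)" by (rule cross_le)
    also have "\<dots> \<le> (c / \<mu> ^ n) * (d / \<mu> ^ n)"
      using assms(3)[OF n] order_trans[OF norm_ge_zero assms(3)[OF n]]
      by (intro mult_mono assms(4)[OF n]) auto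
    finally show ?thesis .
  qed
  moreover have "(\<lambda>n. (c / \<mu> ^ n) * (d / \<mu> ^ n)) \<longlonglongrightarrow> 0 * 0"
    using assms(2) by (intro tendsto_mult inverse_powers_tendsto_0)
  ultimately have "\<bar>cross x y\<bar> \<le> 0 * 0"
    by (intro LIMSEQ_le_const) auto
  then show ?thesis by simp
qed

lemma cocycle_nat_add:
  "cocycle_nat T A (m + n) \<omega> = cocycle_nat T A m ((T ^^ n) \<omega>) ** cocycle_nat T A n \<omega>"
  by (induction m) (simp_all add: matrix_mul_assoc funpow_add)

text \<open>Swapping \<open>(T, A)\<close> with \<open>(T', A')\<close> turns \<open>A\<^sub>n\<close> into \<open>A\<^sub>-\<^sub>n\<close>, so that each statement about the
  stable direction also covers the unstable one.\<close>

locale sl2_cocycle =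
  fixes S :: "'a set" and T T' :: "'a \<Rightarrow> 'a" and A A' :: "'a \<Rightarrow> real^2^2" and M :: real
  assumes T_in: "\<omega> \<in> S \<Longrightarrow> T \<omega> \<in> S" and T'_in: "\<omega> \<in> S \<Longrightarrow> T' \<omega> \<in> S"
    and T'_T: "\<omega> \<in> S \<Longrightarrow> T' (T \<omega>) = \<omega>" and T_T': "\<omega> \<in> S \<Longrightarrow> T (T' \<omega>) = \<omega>"
    and det_A: "\<omega> \<in> S \<Longrightarrow> det (A \<omega>) = 1"
    and A': "\<omega> \<in> S \<Longrightarrow> A' \<omega> = matrix_inv (A (T' \<omega>))"
    and A_le: "\<omega> \<in> S \<Longrightarrow> opnorm (A \<omega>) \<le> M" and M_ge_1: "1 \<le> M"
begin

text \<open>The same \<open>M\<close> serves both systems, since a unimodular matrix and its inverse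
  have equal operator norm.\<close>

lemma inverse: "sl2_cocycle S T' T A' A M"
  by unfold_locales
    (simp_all add: T_in T'_in T'_T T_T' det_A A' det_matrix_inv matrix_inv_matrix_inv opnorm_matrix_inv A_le M_ge_1)

lemma funpow_T_in: "\<omega> \<in> S \<Longrightarrow> (T ^^ n) \<omega> \<in> S"
  by (induction n) (simp_all add: T_in)

lemma funpow_T'_in: "\<omega> \<in> S \<Longrightarrow> (T' ^^ n) \<omega> \<in> S"
  by (induction n) (simp_all add: T'_in)

lemma funpow_T_T': "\<omega> \<in> S \<Longrightarrow> (T ^^ n) ((T' ^^ n) \<omega>) = \<omega>"
  by (induction n) (simp_all add: funpow_swap1[of T] T_T' funpow_T'_in)

lemma det_cocycle: "\<omega> \<in> S \<Longrightarrow> det (cocycle_nat T A n \<omega>) = 1"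
  by (induction n) (simp_all add: det_mul det_A funpow_T_in)

lemma opnorm_cocycle_le: assumes "\<omega> \<in> S" shows "opnorm (cocycle_nat T A n \<omega>) \<le> M ^ n"
proof (induction n)
  case 0
  show ?case by (auto intro: opnorm_leI)
next
  case (Suc n)
  have "opnorm (cocycle_nat T A (Suc n) \<omega>) \<le> opnorm (A ((T ^^ n) \<omega>)) * opnorm (cocycle_nat T A n \<omega>)"
    by (simp add: opnorm_mult)
  also have "\<dots> \<le> M * M ^ n"
    using A_le[OF funpow_T_in[OF assms]] Suc M_ge_1 by (intro mult_mono) (auto simp: opnorm_nonneg)
  finally show ?case by simp
qed

text \<open>Identifies the cocycle of the inverse system with the two-sided cocycle at negative
  times. The induction splits off the first factor of the forward product, whose inverse is applied
  last.\<close>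

lemma cocycle_inverse:
  assumes "\<omega> \<in> S"
  shows "cocycle_nat T' A' n \<omega> = matrix_inv (cocycle_nat T A n ((T' ^^ n) \<omega>))"
proof (induction n)
  case 0
  show ?case by (simp add: matrix_inv_eqI)
next
  case (Suc n)
  define \<eta> where "\<eta> = (T' ^^ n) \<omega>"
  have \<eta>: "\<eta> \<in> S" using assms funpow_T'_in by (simp add: \<eta>_def)
  have "cocycle_nat T A (Suc n) ((T' ^^ Suc n) \<omega>) = cocycle_nat T A n \<eta> ** A (T' \<eta>)"
    using cocycle_nat_add[of T A n 1 "T' \<eta>"] T_T'[OF \<eta>] by (simp add: \<eta>_def)
  then show ?case
    using Suc \<eta> by (simp add: \<eta>_def[symmetric] A' matrix_inv_mult det_cocycle det_A T'_in)
qed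

lemma cocycle_inverse_funpow:
  assumes "\<omega> \<in> S"
  shows "cocycle_nat T' A' n ((T ^^ n) \<omega>) = matrix_inv (cocycle_nat T A n \<omega>)"
proof -
  interpret inv: sl2_cocycle S T' T A' A M by (rule inverse)
  show ?thesis
    using cocycle_inverse[of "(T ^^ n) \<omega>" n] inv.funpow_T_T'[OF assms, of n] funpow_T_in[OF assms] by simp
qed

section \<open>Exponentially contracted vectors of the cocycle\<close>

text \<open>The orbit is cut into blocks of length \<open>k\<close>. The rate \<open>r\<close> per
  block is \<open>root k r\<close> per step; an incomplete block costs at most \<open>M ^ k\<close>,
  and rounding \<open>n\<close> up to whole blocks costs the factor \<open>r\<close>.\<close>

lemma stable_vectors:
  assumes k: "k \<ge> 1" and \<delta>: "\<delta> > 0"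
    and cond: "\<And>\<omega>. \<omega> \<in> S \<Longrightarrow> opnorm (cocycle_nat T A k \<omega>) > \<rho> \<delta>"
      "\<And>\<omega>. \<omega> \<in> S \<Longrightarrow>
        rp1_abs (contracted_dir (cocycle_nat T A k \<omega>) - contracted_dir (cocycle_nat T' A' k \<omega>)) > \<delta>"
  defines "r \<equiv> \<rho> \<delta> * sin (\<delta> / 2)"
  defines "\<mu> \<equiv> root k r"
  assumes \<omega>: "\<omega> \<in> S"
  shows "\<exists>v. norm v = 1 \<and> (\<forall>n. norm (cocycle_nat T A n \<omega> *v v) \<le> M ^ k * r / \<mu> ^ n)"
proof -
  define B where "B j = cocycle_nat T A k ((T ^^ (k * j)) \<omega>)" for j
  define P where "P n = cocycle_nat T A (k * n) \<omega>" for n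
  have T\<omega>: "(T ^^ m) \<omega> \<in> S" for m using funpow_T_in \<omega> by blast
  \<comment> \<open>The inverse of block \<open>j\<close> is the backward cocycle at the start of
    block \<open>Suc j\<close>, so the separation at that single point applies.\<close>
  have "rp1_abs (contracted_dir (B (Suc j)) - contracted_dir (matrix_inv (B j))) > \<delta>" for j
  proof -
    have "matrix_inv (B j) = cocycle_nat T' A' k ((T ^^ (k * Suc j)) \<omega>)"
      using cocycle_inverse_funpow[OF T\<omega>, of k "k * j"] by (simp add: B_def funpow_add)
    then show ?thesis using cond(2)[OF T\<omega>] by (simp add: B_def)
  qed
  moreover have "P (Suc n) = B n ** P n" for n
    by (simp add: P_def B_def cocycle_nat_add)
  ultimately obtain v where v: "norm v = 1" "\<And>n. norm (P n *v v) \<le> 1 / r ^ n"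
    using stable_vector_exists[of B \<delta> P] \<delta> cond(1) T\<omega> det_cocycle
    unfolding r_def by (force simp: B_def P_def)
  have "\<delta> < pi / 2" using cond(2)[OF \<omega>] rp1_abs_bounds(2) less_le_trans by blast
  then have r1: "r > 1" unfolding r_def using \<rho>_sin_gt_1 \<delta> by blast
  have \<mu>: "\<mu> > 1" "\<mu> ^ k = r" using r1 k by (auto simp: \<mu>_def)
  note M = M_ge_1
  have "norm (cocycle_nat T A n \<omega> *v v) \<le> M ^ k * r / \<mu> ^ n" for n
  proof -
    define q where "q = n div k"
    define i where "i = n mod k"
    have n: "n = i + k * q" and i: "i \<le> k" using k by (auto simp: q_def i_def less_imp_le)
    have "norm (cocycle_nat T A n \<omega> *v v) = norm (cocycle_nat T A i ((T ^^ (k * q)) \<omega>) *v (P q *v v))"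
      by (simp add: n cocycle_nat_add P_def matrix_vector_mul_assoc)
    also have "\<dots> \<le> opnorm (cocycle_nat T A i ((T ^^ (k * q)) \<omega>)) * norm (P q *v v)"
      by (rule norm_le_opnorm)
    also have "\<dots> \<le> M ^ k * (1 / r ^ q)"
      using v(2)[of q] order_trans[OF opnorm_cocycle_le[OF T\<omega>] power_increasing[OF i M]] M
      by (intro mult_mono) auto
    also have "1 / r ^ q \<le> r / \<mu> ^ n"
    proof -
      have "\<mu> ^ n \<le> \<mu> ^ (k + k * q)" using \<mu> i n by (intro power_increasing) auto
      also have "\<dots> = r * r ^ q" using \<mu> by (simp add: power_add power_mult)
      finally show ?thesis using \<mu> r1 by (simp add: divide_simps mult.commute)
    qed
    finally show ?thesis using M by (simp add: mult_left_mono)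
  qed
  then show ?thesis using v(1) by blast
qed

text \<open>\<open>A \<omega> *v x\<close> decays along the orbit of \<open>T \<omega>\<close>, with
  the constant divided by \<open>\<mu>\<close> for the step already taken. Uniqueness then makes it
  parallel to \<open>y\<close>.\<close>

lemma stable_invariant:
  assumes \<mu>: "\<mu> > 1" and \<omega>: "\<omega> \<in> S"
    and x: "x \<noteq> 0" "\<And>n. norm (cocycle_nat T A n \<omega> *v x) \<le> c / \<mu> ^ n"
    and y: "y \<noteq> 0" "\<And>n. norm (cocycle_nat T A n (T \<omega>) *v y) \<le> d / \<mu> ^ n"
  shows "span {A \<omega> *v x} = span {y}"
proof (rule cross_eq_0_span)
  show "A \<omega> *v x \<noteq> 0" using matrix_inv_vec(2)[OF det_A[OF \<omega>], of x] x(1) by auto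
  have "norm (cocycle_nat T A n (T \<omega>) *v (A \<omega> *v x)) \<le> (c / \<mu>) / \<mu> ^ n" for n
    using x(2)[of "Suc n"] cocycle_nat_add[of T A n 1 \<omega>]
    by (simp add: matrix_vector_mul_assoc divide_divide_eq_left)
  then show "cross (A \<omega> *v x) y = 0"
    using stable_vectors_parallel[of "\<lambda>n. cocycle_nat T A n (T \<omega>)"] det_cocycle[OF T_in[OF \<omega>]] \<mu> y(2)
    by blast
qed (rule y(1))

section \<open>From hyperbolicity to separated contracted directions\<close>

text \<open>The image of \<open>v\<close> lies on the unstable line at time \<open>n\<close>.
  Normalised and carried back, it becomes \<open>v\<close> divided by the norm of the image, which
  backward decay bounds.\<close>

lemma unstable_growth:
  assumes inv: "\<And>\<omega>. \<omega> \<in> S \<Longrightarrow> (\<lambda>v. A \<omega> *v v) ` line (u \<omega>) = line (u (T \<omega>))"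
    and decay: "\<And>n \<omega> v. \<lbrakk>n \<ge> 1; \<omega> \<in> S; v \<in> line (u \<omega>); norm v = 1\<rbrakk>
      \<Longrightarrow> norm (cocycle_nat T' A' n \<omega> *v v) \<le> C / \<mu> ^ n"
    and C: "C > 0" "\<mu> > 1" and n: "n \<ge> 1" and \<omega>: "\<omega> \<in> S" and v: "v \<in> line (u \<omega>)" "norm v = 1"
  shows "\<mu> ^ n / C \<le> norm (cocycle_nat T A n \<omega> *v v)"
proof -
  define y where "y = cocycle_nat T A n \<omega> *v v"
  have y: "y \<in> line (u ((T ^^ n) \<omega>))" unfolding y_def
  proof (induction n)
    case (Suc n)
    have "A ((T ^^ n) \<omega>) *v (cocycle_nat T A n \<omega> *v v) \<in> line (u (T ((T ^^ n) \<omega>)))"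
      unfolding inv[OF funpow_T_in[OF \<omega>], symmetric] using Suc by (rule imageI)
    then show ?case by (simp add: matrix_vector_mul_assoc)
  qed (use v in simp)
  have yv: "cocycle_nat T' A' n ((T ^^ n) \<omega>) *v y = v"
    by (simp add: cocycle_inverse_funpow[OF \<omega>] y_def matrix_inv_vec det_cocycle[OF \<omega>])
  have y0: "y \<noteq> 0" using yv v(2) by auto
  have "norm (cocycle_nat T' A' n ((T ^^ n) \<omega>) *v ((1 / norm y) *\<^sub>R y)) \<le> C / \<mu> ^ n"
    using y y0 by (intro decay n funpow_T_in \<omega> scaleR_in_line) auto
  then have "1 / norm y \<le> C / \<mu> ^ n" using y0 by (simp add: matrix_vector_mult_scaleR yv v)
  then show ?thesis
    unfolding y_def[symmetric] using y0 C by (simp add: field_simps)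
qed

text \<open>Invariance at \<open>T' \<omega>\<close>, undone by the inverse matrix. It transfers a
  line field between the two systems.\<close>

lemma line_inverse_invariant:
  assumes inv: "\<And>\<omega>. \<omega> \<in> S \<Longrightarrow> (\<lambda>v. A \<omega> *v v) ` line (u \<omega>) = line (u (T \<omega>))" and \<omega>: "\<omega> \<in> S"
  shows "(\<lambda>v. A' \<omega> *v v) ` line (u \<omega>) = line (u (T' \<omega>))"
  using inv[OF T'_in[OF \<omega>], symmetric]
  by (simp add: T_T' A' \<omega> image_image matrix_inv_vec det_A T'_in)

text \<open>Forward growth on \<open>u\<close> and forward decay on \<open>s\<close> force a uniform gap: the component of a unit
  vector of \<open>u\<close> orthogonal to \<open>s\<close> has length the sine of the angle, and after finitely many steps
  it must have grown to at least 1.\<close>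

lemma directions_separated:
  assumes inv: "\<And>\<omega>. \<omega> \<in> S \<Longrightarrow> (\<lambda>v. A \<omega> *v v) ` line (u \<omega>) = line (u (T \<omega>))"
    and C: "C > 0" "\<mu> > 1"
    and decay_u: "\<And>n \<omega> v. \<lbrakk>n \<ge> 1; \<omega> \<in> S; v \<in> line (u \<omega>); norm v = 1\<rbrakk>
      \<Longrightarrow> norm (cocycle_nat T' A' n \<omega> *v v) \<le> C / \<mu> ^ n"
    and decay_s: "\<And>n \<omega> v. \<lbrakk>n \<ge> 1; \<omega> \<in> S; v \<in> line (s \<omega>); norm v = 1\<rbrakk>
      \<Longrightarrow> norm (cocycle_nat T A n \<omega> *v v) \<le> C / \<mu> ^ n"
  obtains \<gamma> where "\<gamma> > 0" "\<And>\<omega>. \<omega> \<in> S \<Longrightarrow> \<gamma> \<le> sin (rp1_abs (s \<omega> - u \<omega>))"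
proof -
  have "\<forall>\<^sub>F n in sequentially. C / \<mu> ^ n < 1 / 2"
    using order_tendstoD(2)[OF inverse_powers_tendsto_0[OF C(2)]] by auto
  then have "\<forall>\<^sub>F n in sequentially. C / \<mu> ^ n < 1 / 2 \<and> n \<ge> 1"
    using eventually_ge_at_top[of 1] by (rule eventually_conj)
  then obtain n where n: "C / \<mu> ^ n < 1 / 2" "n \<ge> 1" by (auto dest!: eventually_happens)
  \<comment> \<open>Growth above 2 against decay below 1 / 2 leaves more than 1 for the orthogonal
    component \<open>x\<close>.\<close>
  have big: "\<mu> ^ n / C > 2" using n(1) C by (simp add: field_simps)
  have "1 / M ^ n \<le> sin (rp1_abs (s \<omega> - u \<omega>))" if \<omega>: "\<omega> \<in> S" for \<omega>
  proof -
    obtain v w where v: "v \<in> line (u \<omega>)" "norm v = 1" and w: "w \<in> line (s \<omega>)" "norm w = 1"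
      using unit_vector_in_line by blast
    define x where "x = v - (w \<bullet> v) *\<^sub>R w"
    have "\<bar>w \<bullet> v\<bar> \<le> 1" using Cauchy_Schwarz_ineq2[of w v] v w by simp
    have "(norm x)\<^sup>2 = (cross w v)\<^sup>2"
      using cross_inner[of w v] v w unfolding x_def power2_norm_eq_inner norm_eq_1
      by (simp add: inner_diff_left inner_diff_right inner_commute power2_eq_square algebra_simps)
    then have nx: "norm x = \<bar>cross w v\<bar>" by (metis abs_norm_cancel power2_eq_iff abs_minus_cancel)
    let ?P = "cocycle_nat T A n \<omega>"
    have "2 < norm (?P *v v)"
      using unstable_growth[OF inv decay_u C n(2) \<omega> v] big by linarith
    also have "?P *v v = ?P *v x + (w \<bullet> v) *\<^sub>R (?P *v w)"
      by (simp add: x_def matrix_vector_mult_diff_distrib matrix_vector_mult_scaleR)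
    also have "norm \<dots> \<le> norm (?P *v x) + \<bar>w \<bullet> v\<bar> * norm (?P *v w)"
      by (metis norm_scaleR norm_triangle_ineq)
    also have "\<dots> \<le> norm (?P *v x) + 1 * (1 / 2)"
      using order_trans[OF decay_s[OF n(2) \<omega> w] less_imp_le[OF n(1)]] \<open>\<bar>w \<bullet> v\<bar> \<le> 1\<close>
      by (intro add_left_mono mult_mono) auto
    finally have "1 \<le> norm (?P *v x)" by simp
    also have "\<dots> \<le> opnorm ?P * norm x" by (rule norm_le_opnorm)
    also have "\<dots> \<le> M ^ n * norm x" by (intro mult_right_mono opnorm_cocycle_le \<omega>) auto
    also have "norm x = sin (rp1_abs (s \<omega> - u \<omega>))"
      using cross_lines[OF w(1) v(1)] v w nx by simp
    finally show ?thesis using M_ge_1 by (simp add: field_simps)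
  qed
  then show thesis using that[of "1 / M ^ n"] M_ge_1 by simp
qed

text \<open>For large \<open>k\<close>, growth along \<open>u\<close> gives the norm bound, and
  decay puts \<open>s\<close> and \<open>u\<close> close to the contracted directions, which inherit
  their gap.\<close>

lemma hyperbolic_imp_contracted_dirs:
  assumes inv_u: "\<And>\<omega>. \<omega> \<in> S \<Longrightarrow> (\<lambda>v. A \<omega> *v v) ` line (u \<omega>) = line (u (T \<omega>))"
    and C: "C > 0" "\<mu> > 1"
    and decay_u: "\<And>n \<omega> v. \<lbrakk>n \<ge> 1; \<omega> \<in> S; v \<in> line (u \<omega>); norm v = 1\<rbrakk>
      \<Longrightarrow> norm (cocycle_nat T' A' n \<omega> *v v) \<le> C / \<mu> ^ n"
    and decay_s: "\<And>n \<omega> v. \<lbrakk>n \<ge> 1; \<omega> \<in> S; v \<in> line (s \<omega>); norm v = 1\<rbrakk>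
      \<Longrightarrow> norm (cocycle_nat T A n \<omega> *v v) \<le> C / \<mu> ^ n"
  shows "\<exists>k\<ge>1. \<exists>\<delta>>0. \<forall>\<omega>\<in>S. opnorm (cocycle_nat T A k \<omega>) > \<rho> \<delta> \<and>
    rp1_abs (contracted_dir (cocycle_nat T A k \<omega>) - contracted_dir (cocycle_nat T' A' k \<omega>)) > \<delta>"
proof -
  interpret inv: sl2_cocycle S T' T A' A M by (rule inverse)
  obtain \<gamma> where \<gamma>: "\<gamma> > 0" "\<And>\<omega>. \<omega> \<in> S \<Longrightarrow> \<gamma> \<le> sin (rp1_abs (s \<omega> - u \<omega>))"
    using directions_separated[OF inv_u C decay_u decay_s] by blast
  \<comment> \<open>Of the gap \<open>4 * \<delta>\<close>, the two approximation errors consume at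
    most \<open>2 * \<delta>\<close>.\<close>
  define \<delta> where "\<delta> = \<gamma> / 4"
  have \<delta>: "\<delta> > 0" using \<gamma> by (simp add: \<delta>_def)
  have \<rho>: "\<rho> \<delta> > 1" by (rule \<rho>_gt_1[OF \<delta>])
  \<comment> \<open>The first bound makes the growth exceed \<open>\<rho> \<delta>\<close>; the
    second controls the error of the directions.\<close>
  define e where "e = min (1 / \<rho> \<delta>) \<delta>"
  have "e > 0" using \<rho> \<delta> by (simp add: e_def)
  then have "\<forall>\<^sub>F n in sequentially. C / \<mu> ^ n < e"
    using order_tendstoD(2)[OF inverse_powers_tendsto_0[OF C(2)]] by auto
  then have "\<forall>\<^sub>F n in sequentially. C / \<mu> ^ n < e \<and> n \<ge> 1"
    using eventually_ge_at_top[of 1] by (rule eventually_conj)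
  then obtain k where k: "C / \<mu> ^ k < e" "k \<ge> 1" by (auto dest!: eventually_happens)
  have big: "\<mu> ^ k / C > \<rho> \<delta>"
  proof -
    have "C / \<mu> ^ k < 1 / \<rho> \<delta>" using k by (simp add: e_def)
    then show ?thesis using C \<rho> by (simp add: field_simps)
  qed
  have op: "opnorm (cocycle_nat T A k \<omega>) > \<rho> \<delta>" if \<omega>: "\<omega> \<in> S" for \<omega>
  proof -
    obtain v where v: "v \<in> line (u \<omega>)" "norm v = 1"
      using unit_vector_in_line by blast
    have "\<rho> \<delta> < norm (cocycle_nat T A k \<omega> *v v)"
      using unstable_growth[OF inv_u decay_u C k(2) \<omega> v] big by linarith
    also have "\<dots> \<le> opnorm (cocycle_nat T A k \<omega>)"
      using norm_le_opnorm[of "cocycle_nat T A k \<omega>" v] v by simp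
    finally show ?thesis .
  qed
  \<comment> \<open>The decay bounds the norm times the sine, hence the sine, as the norm exceeds
    1.\<close>
  have near: "sin (rp1_abs (\<theta> - contracted_dir D)) \<le> \<delta>"
    if D: "det D = 1" "opnorm D > 1" and "\<And>v. \<lbrakk>v \<in> line \<theta>; norm v = 1\<rbrakk> \<Longrightarrow> norm (D *v v) \<le> C / \<mu> ^ k"
    for D \<theta>
  proof -
    obtain v where v: "v \<in> line \<theta>" "norm v = 1"
      using unit_vector_in_line by blast
    define x where "x = sin (rp1_abs (\<theta> - contracted_dir D))"
    have "0 \<le> x" unfolding x_def
      using rp1_abs_bounds[of "\<theta> - contracted_dir D"] pi_gt_zero by (intro sin_ge_zero) linarith+
    then have "x \<le> opnorm D * x" using D(2) mult_right_mono[of 1 "opnorm D" x] by simp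
    also have "\<dots> \<le> C / \<mu> ^ k" using contracted_dir_bound[OF D v(1)] that(3)[OF v] v(2) by (simp add: x_def)
    also have "\<dots> \<le> \<delta>" using k(1) by (simp add: e_def)
    finally show ?thesis by (simp add: x_def)
  qed
  have "rp1_abs (contracted_dir (cocycle_nat T A k \<omega>) - contracted_dir (cocycle_nat T' A' k \<omega>)) > \<delta>"
    if \<omega>: "\<omega> \<in> S" for \<omega>
  proof -
    define p where "p = contracted_dir (cocycle_nat T A k \<omega>)"
    define q where "q = contracted_dir (cocycle_nat T' A' k \<omega>)"
    have s: "sin (rp1_abs (s \<omega> - p)) \<le> \<delta>" unfolding p_def
      using det_cocycle[OF \<omega>] op[OF \<omega>] \<rho> decay_s[OF k(2) \<omega>] by (intro near) auto
    \<comment> \<open>The backward matrix has the norm of the forward matrix at the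
      \<open>k\<close>-fold preimage, where \<open>op\<close> applies.\<close>
    have "opnorm (cocycle_nat T' A' k \<omega>) = opnorm (cocycle_nat T A k ((T' ^^ k) \<omega>))"
      by (simp add: cocycle_inverse[OF \<omega>] opnorm_matrix_inv det_cocycle funpow_T'_in[OF \<omega>])
    then have u: "sin (rp1_abs (u \<omega> - q)) \<le> \<delta>" unfolding q_def
      using inv.det_cocycle[OF \<omega>] op[OF funpow_T'_in[OF \<omega>, of k]] \<rho> decay_u[OF k(2) \<omega>]
      by (intro near) auto
    have "4 * \<delta> \<le> sin (rp1_abs (s \<omega> - u \<omega>))" using \<gamma>(2)[OF \<omega>] by (simp add: \<delta>_def)
    also have "\<dots> \<le> sin (rp1_abs (s \<omega> - p)) + sin (rp1_abs (p - q)) + sin (rp1_abs (q - u \<omega>))"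
      using sin_rp1_abs_triangle[of "s \<omega> - p" "p - u \<omega>"] sin_rp1_abs_triangle[of "p - q" "q - u \<omega>"] by simp
    also have "\<dots> \<le> \<delta> + rp1_abs (p - q) + \<delta>"
      using s u rp1_abs_minus[of q "u \<omega>"] sin_x_le_x[OF rp1_abs_bounds(1), of "p - q"] by simp
    finally show ?thesis using \<delta> by (simp add: p_def q_def)
  qed
  then show ?thesis using op k(2) \<delta> by blast
qed

section \<open>Invariant stable directions from the cone condition\<close>

text \<open>Vectors chosen point by point span a line field, and uniqueness of the stable direction
  makes it invariant. A point of \<open>S\<close> is what yields \<open>\<delta> < pi / 2\<close>,
  so that the rate exceeds 1.\<close>

lemma stable_directions:
  assumes k: "k \<ge> 1" and \<delta>: "\<delta> > 0"
    and cond: "\<And>\<omega>. \<omega> \<in> S \<Longrightarrow> opnorm (cocycle_nat T A k \<omega>) > \<rho> \<delta>"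
      "\<And>\<omega>. \<omega> \<in> S \<Longrightarrow>
        rp1_abs (contracted_dir (cocycle_nat T A k \<omega>) - contracted_dir (cocycle_nat T' A' k \<omega>)) > \<delta>"
    and ne: "S \<noteq> {}"
  obtains s :: "'a \<Rightarrow> rp1"
  where "\<And>\<omega>. \<omega> \<in> S \<Longrightarrow> (\<lambda>v. A \<omega> *v v) ` line (s \<omega>) = line (s (T \<omega>))"
    and "\<And>n \<omega> v. \<lbrakk>\<omega> \<in> S; v \<in> line (s \<omega>); norm v = 1\<rbrakk> \<Longrightarrow> norm (cocycle_nat T A n \<omega> *v v)
      \<le> M ^ k * (\<rho> \<delta> * sin (\<delta> / 2)) / root k (\<rho> \<delta> * sin (\<delta> / 2)) ^ n"
proof -
  define C where "C = M ^ k * (\<rho> \<delta> * sin (\<delta> / 2))"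
  define \<mu> where "\<mu> = root k (\<rho> \<delta> * sin (\<delta> / 2))"
  have "\<delta> < pi / 2" using cond(2) ne rp1_abs_bounds(2) less_le_trans by blast
  then have \<mu>: "\<mu> > 1" using \<rho>_sin_gt_1[OF \<delta>] k by (simp add: \<mu>_def)
  have "\<forall>\<omega>\<in>S. \<exists>v. norm v = 1 \<and> (\<forall>n. norm (cocycle_nat T A n \<omega> *v v) \<le> C / \<mu> ^ n)"
    using stable_vectors[OF k \<delta> cond] by (simp add: C_def \<mu>_def)
  then obtain x where x: "\<And>\<omega>. \<omega> \<in> S \<Longrightarrow> norm (x \<omega>) = 1"
    "\<And>\<omega> n. \<omega> \<in> S \<Longrightarrow> norm (cocycle_nat T A n \<omega> *v x \<omega>) \<le> C / \<mu> ^ n"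
    by metis
  have x0: "x \<omega> \<noteq> 0" if "\<omega> \<in> S" for \<omega> using x(1)[OF that] by auto
  then have "\<forall>\<omega>\<in>S. \<exists>\<theta>. line \<theta> = span {x \<omega>}" using span_eq_line by blast
  then obtain s where s: "\<And>\<omega>. \<omega> \<in> S \<Longrightarrow> line (s \<omega>) = span {x \<omega>}" by metis
  show thesis
  proof (rule that[of s], fold C_def \<mu>_def)
    fix \<omega> assume \<omega>: "\<omega> \<in> S"
    then have "(\<lambda>v. A \<omega> *v v) ` line (s \<omega>) = span {A \<omega> *v x \<omega>}"
      using image_line[OF det_A[OF \<omega>], of "x \<omega>" "s \<omega>"] x0 s by (simp add: span_base)
    also have "\<dots> = line (s (T \<omega>))"
      using stable_invariant[OF \<mu> \<omega> x0[OF \<omega>] x(2)[OF \<omega>] x0[OF T_in[OF \<omega>]] x(2)[OF T_in[OF \<omega>]]]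
      by (simp add: s T_in \<omega>)
    finally show "(\<lambda>v. A \<omega> *v v) ` line (s \<omega>) = line (s (T \<omega>))" .
  next
    fix n \<omega> v assume \<omega>: "\<omega> \<in> S" and v: "v \<in> line (s \<omega>)" "norm v = 1"
    then obtain c where c: "v = c *\<^sub>R x \<omega>" by (auto simp: s span_singleton)
    then have "\<bar>c\<bar> = 1" using v(2) x(1)[OF \<omega>] by simp
    then show "norm (cocycle_nat T A n \<omega> *v v) \<le> C / \<mu> ^ n"
      using x(2)[OF \<omega>, of n] by (simp add: c matrix_vector_mult_scaleR)
  qed
qed

end

section \<open>Compactness and the equivalence\<close>

lemma bounded_opnorm:
  assumes "compact_space X" "continuous_map X (top_of_set SL2) A"
  obtains M where "1 \<le> M" "\<And>\<omega>. \<omega> \<in> topspace X \<Longrightarrow> opnorm (A \<omega>) \<le> M"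
proof -
  have "continuous_map X euclidean A"
    using assms(2) by (simp add: continuous_map_in_subtopology)
  then have "compact (A ` topspace X)"
    using image_compactin[of X "topspace X" euclidean A] assms(1) by (simp add: compact_space_def)
  then obtain b where b: "\<And>\<omega>. \<omega> \<in> topspace X \<Longrightarrow> norm (A \<omega>) \<le> b"
    using compact_imp_bounded bounded_iff by (metis imageI)
  show thesis
  \<comment> \<open>All four entries are bounded by the Frobenius norm; the maximum secures the
    lower bound 1.\<close>
  proof (rule that[of "max 1 (4 * b)"])
    fix \<omega> assume \<omega>: "\<omega> \<in> topspace X"
    have "\<bar>A \<omega> $ i $ j\<bar> \<le> b" for i j
      using component_le_norm_cart[of "A \<omega> $ i" j] Finite_Cartesian_Product.norm_nth_le[of "A \<omega>" i] b[OF \<omega>] by linarith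
    from onorm_le_matrix_component[of "A \<omega>" b, OF this]
    show "opnorm (A \<omega>) \<le> max 1 (4 * b)" by (simp add: opnorm_def)
  qed simp
qed

theorem corollary3:
  fixes X :: "'a topology" and T :: "'a \<Rightarrow> 'a" and A :: "'a \<Rightarrow> real^2^2"
  assumes "compact_space X"
    and "homeomorphic_map X X T"
    and "continuous_map X (top_of_set SL2) A"
  shows "uniformly_hyperbolic X T A \<longleftrightarrow>
    (\<exists>k::nat. \<exists>\<delta>\<^sub>0::real. k \<ge> 1 \<and> \<delta>\<^sub>0 > 0 \<and>
       (\<forall>\<omega>\<in>topspace X. opnorm (cocycle X T A (int k) \<omega>) > \<rho> \<delta>\<^sub>0 \<and>
          rp1_abs (s_dir X T A k \<omega> - u_dir X T A k \<omega>) > \<delta>\<^sub>0))"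
proof -
  define S where "S = topspace X"
  \<comment> \<open>The map that \<open>iter_int\<close> iterates at negative times.\<close>
  define T' where "T' = inv_into S T"
  define A' where "A' \<omega> = matrix_inv (A (T' \<omega>))" for \<omega>
  obtain M where M: "1 \<le> M" "\<And>\<omega>. \<omega> \<in> S \<Longrightarrow> opnorm (A \<omega>) \<le> M"
    using bounded_opnorm[OF assms(1,3)] unfolding S_def by blast
  have img: "T ` S = S" and inj: "inj_on T S"
    using homeomorphic_imp_surjective_map[OF assms(2)] homeomorphic_imp_injective_map[OF assms(2)]
    by (simp_all add: S_def)
  have det: "det (A \<omega>) = 1" if "\<omega> \<in> S" for \<omega>
    using assms(3) that by (auto simp: continuous_map_in_subtopology SL2_def S_def)
  interpret sl2_cocycle S T T' A A' M
  proof
    fix \<omega> assume \<omega>: "\<omega> \<in> S"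
    show "T \<omega> \<in> S" using img \<omega> by blast
    show "T' \<omega> \<in> S" using img \<omega> inv_into_into[of \<omega> T S] by (simp add: T'_def)
    show "T' (T \<omega>) = \<omega>" using inj \<omega> by (simp add: T'_def)
    show "T (T' \<omega>) = \<omega>" using img \<omega> f_inv_into_f[of \<omega> T S] by (simp add: T'_def)
  qed (use det M A'_def in auto)
  interpret inv: sl2_cocycle S T' T A' A M by (rule inverse)
  have fw: "cocycle X T A (int n) \<omega> = cocycle_nat T A n \<omega>" for n \<omega>
    by (simp add: cocycle_def)
  have bw: "cocycle X T A (- int n) \<omega> = cocycle_nat T' A' n \<omega>" if "\<omega> \<in> S" for n \<omega>
  proof (cases "n = 0")
    case False
    then show ?thesis
      by (simp add: cocycle_def iter_int_def cocycle_inverse[OF that] flip: T'_def S_def)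
  qed (simp add: cocycle_def)
  have act: "rp1_act (A \<omega>) \<theta> = \<eta> \<longleftrightarrow> (\<lambda>v. A \<omega> *v v) ` line \<theta> = line \<eta>" if "\<omega> \<in> S" for \<omega> \<theta> \<eta>
    using rp1_act_eq_iff[OF det[OF that]] by auto
  have UH: "uniformly_hyperbolic X T A \<longleftrightarrow>
     (\<exists>u s. (\<forall>\<omega>\<in>S. (\<lambda>v. A \<omega> *v v) ` line (u \<omega>) = line (u (T \<omega>)) \<and>
                  (\<lambda>v. A \<omega> *v v) ` line (s \<omega>) = line (s (T \<omega>))) \<and>
        (\<exists>C \<mu>. C > 0 \<and> \<mu> > 1 \<and> (\<forall>n\<ge>1. \<forall>\<omega>\<in>S.
           (\<forall>v\<in>line (u \<omega>). norm v = 1 \<longrightarrow> norm (cocycle_nat T' A' n \<omega> *v v) \<le> C / \<mu> ^ n) \<and>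
           (\<forall>w\<in>line (s \<omega>). norm w = 1 \<longrightarrow> norm (cocycle_nat T A n \<omega> *v w) \<le> C / \<mu> ^ n))))"
    (is "_ \<longleftrightarrow> ?U")
    unfolding uniformly_hyperbolic_def S_def[symmetric]
    by (simp add: act fw bw power_int_minus divide_inverse cong: ball_cong)
  have RHS: "(\<exists>k::nat. \<exists>\<delta>\<^sub>0::real. k \<ge> 1 \<and> \<delta>\<^sub>0 > 0 \<and>
       (\<forall>\<omega>\<in>topspace X. opnorm (cocycle X T A (int k) \<omega>) > \<rho> \<delta>\<^sub>0 \<and>
          rp1_abs (s_dir X T A k \<omega> - u_dir X T A k \<omega>) > \<delta>\<^sub>0)) \<longleftrightarrow>
    (\<exists>k\<ge>1. \<exists>\<delta>>0. \<forall>\<omega>\<in>S. opnorm (cocycle_nat T A k \<omega>) > \<rho> \<delta> \<and>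
      rp1_abs (contracted_dir (cocycle_nat T A k \<omega>) - contracted_dir (cocycle_nat T' A' k \<omega>)) > \<delta>)"
    (is "_ \<longleftrightarrow> ?R")
    unfolding S_def[symmetric] s_dir_def u_dir_def fw by (auto simp: bw cong: ball_cong)
  show ?thesis unfolding UH RHS
  proof
    assume ?U
    then obtain u s C \<mu> where U: "\<forall>\<omega>\<in>S. (\<lambda>v. A \<omega> *v v) ` line (u \<omega>) = line (u (T \<omega>)) \<and>
        (\<lambda>v. A \<omega> *v v) ` line (s \<omega>) = line (s (T \<omega>))"
      "C > 0" "\<mu> > 1"
      "\<forall>n\<ge>1. \<forall>\<omega>\<in>S.
        (\<forall>v\<in>line (u \<omega>). norm v = 1 \<longrightarrow> norm (cocycle_nat T' A' n \<omega> *v v) \<le> C / \<mu> ^ n) \<and>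
        (\<forall>w\<in>line (s \<omega>). norm w = 1 \<longrightarrow> norm (cocycle_nat T A n \<omega> *v w) \<le> C / \<mu> ^ n)"
      by (elim exE conjE) (rule that)
    show ?R
      by (rule hyperbolic_imp_contracted_dirs[of u C \<mu> s]) (use U in blast)+
  next
    assume ?R
    then obtain k \<delta> where k: "k \<ge> 1" and \<delta>: "\<delta> > 0"
      and op: "\<And>\<omega>. \<omega> \<in> S \<Longrightarrow> opnorm (cocycle_nat T A k \<omega>) > \<rho> \<delta>"
      and dir: "\<And>\<omega>. \<omega> \<in> S \<Longrightarrow>
        rp1_abs (contracted_dir (cocycle_nat T A k \<omega>) - contracted_dir (cocycle_nat T' A' k \<omega>)) > \<delta>"
      by blast
    \<comment> \<open>The conditions survive time reversal: norms agree at shifted points, and the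
      distance is symmetric.\<close>
    have op': "opnorm (cocycle_nat T' A' k \<omega>) > \<rho> \<delta>" if "\<omega> \<in> S" for \<omega>
      using op[OF funpow_T'_in[OF that, of k]]
      by (simp add: cocycle_inverse[OF that] opnorm_matrix_inv det_cocycle funpow_T'_in[OF that])
    have dir': "rp1_abs (contracted_dir (cocycle_nat T' A' k \<omega>) - contracted_dir (cocycle_nat T A k \<omega>)) > \<delta>"
      if "\<omega> \<in> S" for \<omega>
      using dir[OF that] rp1_abs_minus by metis
    show ?U
    proof (cases "S = {}")
      case True
      \<comment> \<open>Without points only the constants remain, and 1 and 2 serve.\<close>
      then show ?thesis by (auto intro: exI[of _ 1] exI[of _ 2])
    next
      case False
      define C where "C = M ^ k * (\<rho> \<delta> * sin (\<delta> / 2))"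
      define \<mu> where "\<mu> = root k (\<rho> \<delta> * sin (\<delta> / 2))"
      have "\<delta> < pi / 2" using dir False rp1_abs_bounds(2) less_le_trans by blast
      then have r: "\<rho> \<delta> * sin (\<delta> / 2) > 1" using \<rho>_sin_gt_1 \<delta> by blast
      then have C: "C > 0" "\<mu> > 1" using k M(1) by (simp_all add: C_def \<mu>_def del: zero_less_mult_iff)
      obtain s where s: "\<And>\<omega>. \<omega> \<in> S \<Longrightarrow> (\<lambda>v. A \<omega> *v v) ` line (s \<omega>) = line (s (T \<omega>))"
        "\<And>n \<omega> v. \<lbrakk>\<omega> \<in> S; v \<in> line (s \<omega>); norm v = 1\<rbrakk> \<Longrightarrow> norm (cocycle_nat T A n \<omega> *v v) \<le> C / \<mu> ^ n"
        using stable_directions[OF k \<delta> op dir False, folded C_def \<mu>_def] by blast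
      obtain u where u: "\<And>\<omega>. \<omega> \<in> S \<Longrightarrow> (\<lambda>v. A' \<omega> *v v) ` line (u \<omega>) = line (u (T' \<omega>))"
        "\<And>n \<omega> v. \<lbrakk>\<omega> \<in> S; v \<in> line (u \<omega>); norm v = 1\<rbrakk> \<Longrightarrow> norm (cocycle_nat T' A' n \<omega> *v v) \<le> C / \<mu> ^ n"
        using inv.stable_directions[OF k \<delta> op' dir' False, folded C_def \<mu>_def] by blast
      note u_inv = inv.line_inverse_invariant[of u, OF u(1)]
      show ?thesis
        by (intro exI[of _ u] exI[of _ s] exI[of _ C] exI[of _ \<mu>] conjI ballI allI impI)
          (simp_all add: C s u u_inv)
    qed
  qed
qed

end
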